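(* Let $\mathcal{D}$ be a $\lambda$-pretopos. Then filtered colimits of size $<\lambda$ in $\mathcal{D}$ commute with finite limits.
   Context: $\lambda$ is an infinite regular cardinal. A $\lambda$-geometric category is a coherent category with pullback-stable unions of fewer than $\lambda$ subobjects. A $\lambda$-pretopos is a $\lambda$-geometric category which is Barr-exact (internal equivalence relations are effective, i.e. have quotients of which they are the kernel pairs) and has disjoint, pullback-stable coproducts of size $<\lambda$. A filtered colimit of size $<\lambda$ is a colimit of a diagram indexed by a filtered category with fewer than $\lambda$ morphisms (such colimits exist in every $\lambda$-pretopos). *)

theory Defs
  imports Main
begin

unbundle cardinal_syntax

section \<open>Categories and functors\<close>

record ('o, 'a) cat =
  Ob :: "'o set"
  Ar :: "'a set"
  Dom :: "'a \<Rightarrow> 'o"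
  Cod :: "'a \<Rightarrow> 'o"
  ident :: "'o \<Rightarrow> 'a"
  cmp :: "'a \<Rightarrow> 'a \<Rightarrow> 'a" (infixl \<open>\<cdot>\<index>\<close> 70)

text \<open>Composition is written in applicative order: \<open>g \<cdot>\<^bsub>C\<^esub> f\<close> is \<open>f\<close> followed by \<open>g\<close>.\<close>

definition hom :: "('o, 'a) cat \<Rightarrow> 'o \<Rightarrow> 'o \<Rightarrow> 'a set" where
  "hom C x y = {f \<in> Ar C. Dom C f = x \<and> Cod C f = y}"

locale category =
  fixes C :: "('o, 'a) cat" (structure)
  assumes Dom_in_Ob: "f \<in> Ar C \<Longrightarrow> Dom C f \<in> Ob C"
    and Cod_in_Ob: "f \<in> Ar C \<Longrightarrow> Cod C f \<in> Ob C"
    and ident_in_hom: "x \<in> Ob C \<Longrightarrow> ident C x \<in> hom C x x"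
    and cmp_in_hom: "\<lbrakk>f \<in> hom C x y; g \<in> hom C y z\<rbrakk> \<Longrightarrow> g \<cdot> f \<in> hom C x z"
    and cmp_ident_right: "f \<in> hom C x y \<Longrightarrow> f \<cdot> ident C x = f"
    and cmp_ident_left: "f \<in> hom C x y \<Longrightarrow> ident C y \<cdot> f = f"
    and cmp_assoc: "\<lbrakk>f \<in> hom C w x; g \<in> hom C x y; h \<in> hom C y z\<rbrakk>
      \<Longrightarrow> (h \<cdot> g) \<cdot> f = h \<cdot> (g \<cdot> f)"

definition prod_cat :: "('i, 'j) cat \<Rightarrow> ('k, 'n) cat \<Rightarrow> ('i \<times> 'k, 'j \<times> 'n) cat" where
  "prod_cat J K =
    \<lparr> Ob = Ob J \<times> Ob K,
      Ar = Ar J \<times> Ar K,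
      Dom = (\<lambda>(f, g). (Dom J f, Dom K g)),
      Cod = (\<lambda>(f, g). (Cod J f, Cod K g)),
      ident = (\<lambda>(x, y). (ident J x, ident K y)),
      cmp = (\<lambda>(f', g') (f, g). (f' \<cdot>\<^bsub>J\<^esub> f, g' \<cdot>\<^bsub>K\<^esub> g)) \<rparr>"

record ('i, 'j, 'o, 'a) func =
  ob :: "'i \<Rightarrow> 'o"
  ar :: "'j \<Rightarrow> 'a"

definition is_functor :: "('i, 'j) cat \<Rightarrow> ('o, 'a) cat \<Rightarrow> ('i, 'j, 'o, 'a) func \<Rightarrow> bool" where
  "is_functor J C F \<longleftrightarrow>
    (\<forall>x \<in> Ob J. ob F x \<in> Ob C) \<and>
    (\<forall>f \<in> Ar J. ar F f \<in> hom C (ob F (Dom J f)) (ob F (Cod J f))) \<and>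
    (\<forall>x \<in> Ob J. ar F (ident J x) = ident C (ob F x)) \<and>
    (\<forall>f \<in> Ar J. \<forall>g \<in> Ar J. Dom J g = Cod J f \<longrightarrow>
      ar F (g \<cdot>\<^bsub>J\<^esub> f) = ar F g \<cdot>\<^bsub>C\<^esub> ar F f)"

text \<open>For a functor \<open>F\<close> on \<open>J \<times> K\<close>, the functors \<open>F(j, -)\<close> on \<open>K\<close> and \<open>F(-, k)\<close> on \<open>J\<close>.\<close>

definition fix_fst ::
    "('i, 'j) cat \<Rightarrow> ('i \<times> 'k, 'j \<times> 'n, 'o, 'a) func \<Rightarrow> 'i \<Rightarrow> ('k, 'n, 'o, 'a) func" where
  "fix_fst J F j = \<lparr> ob = (\<lambda>k. ob F (j, k)), ar = (\<lambda>g. ar F (ident J j, g)) \<rparr>"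

definition fix_snd ::
    "('k, 'n) cat \<Rightarrow> ('i \<times> 'k, 'j \<times> 'n, 'o, 'a) func \<Rightarrow> 'k \<Rightarrow> ('i, 'j, 'o, 'a) func" where
  "fix_snd K F k = \<lparr> ob = (\<lambda>j. ob F (j, k)), ar = (\<lambda>f. ar F (f, ident K k)) \<rparr>"


section \<open>Limits and colimits\<close>

definition is_cone ::
    "('i, 'j) cat \<Rightarrow> ('o, 'a) cat \<Rightarrow> ('i, 'j, 'o, 'a) func \<Rightarrow> 'o \<Rightarrow> ('i \<Rightarrow> 'a) \<Rightarrow> bool" where
  "is_cone J C F x p \<longleftrightarrow>
    x \<in> Ob C \<and>
    (\<forall>i \<in> Ob J. p i \<in> hom C x (ob F i)) \<and>
    (\<forall>f \<in> Ar J. ar F f \<cdot>\<^bsub>C\<^esub> p (Dom J f) = p (Cod J f))"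

definition is_limit ::
    "('i, 'j) cat \<Rightarrow> ('o, 'a) cat \<Rightarrow> ('i, 'j, 'o, 'a) func \<Rightarrow> 'o \<Rightarrow> ('i \<Rightarrow> 'a) \<Rightarrow> bool" where
  "is_limit J C F x p \<longleftrightarrow>
    is_cone J C F x p \<and>
    (\<forall>y q. is_cone J C F y q \<longrightarrow>
      (\<exists>!h. h \<in> hom C y x \<and> (\<forall>i \<in> Ob J. p i \<cdot>\<^bsub>C\<^esub> h = q i)))"

definition is_cocone ::
    "('i, 'j) cat \<Rightarrow> ('o, 'a) cat \<Rightarrow> ('i, 'j, 'o, 'a) func \<Rightarrow> 'o \<Rightarrow> ('i \<Rightarrow> 'a) \<Rightarrow> bool" where
  "is_cocone J C F x p \<longleftrightarrow>
    x \<in> Ob C \<and>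
    (\<forall>i \<in> Ob J. p i \<in> hom C (ob F i) x) \<and>
    (\<forall>f \<in> Ar J. p (Cod J f) \<cdot>\<^bsub>C\<^esub> ar F f = p (Dom J f))"

definition is_colimit ::
    "('i, 'j) cat \<Rightarrow> ('o, 'a) cat \<Rightarrow> ('i, 'j, 'o, 'a) func \<Rightarrow> 'o \<Rightarrow> ('i \<Rightarrow> 'a) \<Rightarrow> bool" where
  "is_colimit J C F x p \<longleftrightarrow>
    is_cocone J C F x p \<and>
    (\<forall>y q. is_cocone J C F y q \<longrightarrow>
      (\<exists>!h. h \<in> hom C x y \<and> (\<forall>i \<in> Ob J. h \<cdot>\<^bsub>C\<^esub> p i = q i)))"

definition finite_category :: "('i, 'j) cat \<Rightarrow> bool" where
  "finite_category J \<longleftrightarrow> category J \<and> finite (Ar J)"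

definition filtered_category :: "('i, 'j) cat \<Rightarrow> bool" where
  "filtered_category J \<longleftrightarrow>
    category J \<and>
    Ob J \<noteq> {} \<and>
    (\<forall>x \<in> Ob J. \<forall>y \<in> Ob J. \<exists>z \<in> Ob J. hom J x z \<noteq> {} \<and> hom J y z \<noteq> {}) \<and>
    (\<forall>f \<in> Ar J. \<forall>g \<in> Ar J. Dom J f = Dom J g \<and> Cod J f = Cod J g \<longrightarrow>
      (\<exists>h \<in> Ar J. Dom J h = Cod J f \<and> h \<cdot>\<^bsub>J\<^esub> f = h \<cdot>\<^bsub>J\<^esub> g))"

text \<open>A definition cannot quantify over the types of the index category; every finite category
  is isomorphic to one whose objects and arrows are natural numbers, so nothing is lost here.\<close>

definition has_finite_limits :: "('o, 'a) cat \<Rightarrow> bool" where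
  "has_finite_limits C \<longleftrightarrow>
    (\<forall>(K :: (nat, nat) cat) F. finite_category K \<and> is_functor K C F \<longrightarrow>
      (\<exists>x p. is_limit K C F x p))"

definition is_iso :: "('o, 'a) cat \<Rightarrow> 'a \<Rightarrow> bool" where
  "is_iso C f \<longleftrightarrow> f \<in> Ar C \<and>
    (\<exists>g \<in> hom C (Cod C f) (Dom C f).
      g \<cdot>\<^bsub>C\<^esub> f = ident C (Dom C f) \<and> f \<cdot>\<^bsub>C\<^esub> g = ident C (Cod C f))"

definition is_mono :: "('o, 'a) cat \<Rightarrow> 'a \<Rightarrow> bool" where
  "is_mono C m \<longleftrightarrow> m \<in> Ar C \<and>
    (\<forall>f \<in> Ar C. \<forall>g \<in> Ar C.
      Dom C f = Dom C g \<and> Cod C f = Dom C m \<and> Cod C g = Dom C m \<and>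
      m \<cdot>\<^bsub>C\<^esub> f = m \<cdot>\<^bsub>C\<^esub> g \<longrightarrow> f = g)"

definition is_initial :: "('o, 'a) cat \<Rightarrow> 'o \<Rightarrow> bool" where
  "is_initial C x \<longleftrightarrow> x \<in> Ob C \<and> (\<forall>y \<in> Ob C. \<exists>!h. h \<in> hom C x y)"

text \<open>The square \<open>f \<cdot> p = g \<cdot> q\<close> is a pullback; so \<open>p\<close> is a pullback of \<open>g\<close> along \<open>f\<close>.\<close>

definition is_pullback :: "('o, 'a) cat \<Rightarrow> 'a \<Rightarrow> 'a \<Rightarrow> 'a \<Rightarrow> 'a \<Rightarrow> bool" where
  "is_pullback C f g p q \<longleftrightarrow>
    f \<in> Ar C \<and> g \<in> Ar C \<and> p \<in> Ar C \<and> q \<in> Ar C \<and>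
    Cod C f = Cod C g \<and> Dom C p = Dom C q \<and> Cod C p = Dom C f \<and> Cod C q = Dom C g \<and>
    f \<cdot>\<^bsub>C\<^esub> p = g \<cdot>\<^bsub>C\<^esub> q \<and>
    (\<forall>a \<in> Ar C. \<forall>b \<in> Ar C.
      Dom C a = Dom C b \<and> Cod C a = Dom C f \<and> Cod C b = Dom C g \<and>
      f \<cdot>\<^bsub>C\<^esub> a = g \<cdot>\<^bsub>C\<^esub> b \<longrightarrow>
      (\<exists>!h. h \<in> hom C (Dom C a) (Dom C p) \<and> p \<cdot>\<^bsub>C\<^esub> h = a \<and> q \<cdot>\<^bsub>C\<^esub> h = b))"

definition is_coequalizer :: "('o, 'a) cat \<Rightarrow> 'a \<Rightarrow> 'a \<Rightarrow> 'a \<Rightarrow> bool" where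
  "is_coequalizer C f g e \<longleftrightarrow>
    f \<in> Ar C \<and> g \<in> Ar C \<and> e \<in> Ar C \<and>
    Dom C f = Dom C g \<and> Cod C f = Cod C g \<and> Dom C e = Cod C f \<and>
    e \<cdot>\<^bsub>C\<^esub> f = e \<cdot>\<^bsub>C\<^esub> g \<and>
    (\<forall>a \<in> Ar C. Dom C a = Cod C f \<and> a \<cdot>\<^bsub>C\<^esub> f = a \<cdot>\<^bsub>C\<^esub> g \<longrightarrow>
      (\<exists>!h. h \<in> hom C (Cod C e) (Cod C a) \<and> h \<cdot>\<^bsub>C\<^esub> e = a))"

definition is_regular_epi :: "('o, 'a) cat \<Rightarrow> 'a \<Rightarrow> bool" where
  "is_regular_epi C e \<longleftrightarrow> (\<exists>f g. is_coequalizer C f g e)"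


section \<open>Coherent and \<open>\<lambda>\<close>-geometric categories\<close>

definition regular_category :: "('o, 'a) cat \<Rightarrow> bool" where
  "regular_category C \<longleftrightarrow>
    category C \<and>
    has_finite_limits C \<and>
    (\<forall>f \<in> Ar C. \<exists>e m. is_regular_epi C e \<and> is_mono C m \<and>
      Cod C e = Dom C m \<and> f = m \<cdot>\<^bsub>C\<^esub> e) \<and>
    (\<forall>f e p q. is_regular_epi C e \<and> is_pullback C f e p q \<longrightarrow> is_regular_epi C p)"

text \<open>Subobjects of \<open>x\<close> are handled through representing monomorphisms. Isomorphic monomorphisms
  are equivalent for the preorder \<open>sub_le\<close>, so unions are determined up to isomorphism.\<close>

definition monos_into :: "('o, 'a) cat \<Rightarrow> 'o \<Rightarrow> 'a set" where
  "monos_into C x = {m. is_mono C m \<and> Cod C m = x}"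

definition sub_le :: "('o, 'a) cat \<Rightarrow> 'a \<Rightarrow> 'a \<Rightarrow> bool" where
  "sub_le C m n \<longleftrightarrow> (\<exists>h \<in> hom C (Dom C m) (Dom C n). m = n \<cdot>\<^bsub>C\<^esub> h)"

definition is_union :: "('o, 'a) cat \<Rightarrow> 'o \<Rightarrow> 'a set \<Rightarrow> 'a \<Rightarrow> bool" where
  "is_union C x S u \<longleftrightarrow>
    u \<in> monos_into C x \<and>
    (\<forall>m \<in> S. sub_le C m u) \<and>
    (\<forall>v \<in> monos_into C x. (\<forall>m \<in> S. sub_le C m v) \<longrightarrow> sub_le C u v)"

definition is_inverse_image :: "('o, 'a) cat \<Rightarrow> 'a \<Rightarrow> 'a \<Rightarrow> 'a \<Rightarrow> bool" where
  "is_inverse_image C f m m' \<longleftrightarrow> (\<exists>q. is_pullback C f m m' q)"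

text \<open>In the stability clause the set of inverse images contains all representatives of the
  inverse images of the members of \<open>S\<close>; this does not affect their union.\<close>

definition has_stable_union :: "('o, 'a) cat \<Rightarrow> 'o \<Rightarrow> 'a set \<Rightarrow> bool" where
  "has_stable_union C x S \<longleftrightarrow>
    (\<exists>u. is_union C x S u \<and>
      (\<forall>f \<in> Ar C. \<forall>u'. Cod C f = x \<and> is_inverse_image C f u u' \<longrightarrow>
        is_union C (Dom C f) {m'. \<exists>m \<in> S. is_inverse_image C f m m'} u'))"

definition coherent_category :: "('o, 'a) cat \<Rightarrow> bool" where
  "coherent_category C \<longleftrightarrow>
    regular_category C \<and>
    (\<forall>x \<in> Ob C. \<forall>S \<subseteq> monos_into C x. finite S \<longrightarrow> has_stable_union C x S)"

text \<open>Here and below the cardinal \<open>\<lambda>\<close> is represented by a cardinal order \<open>r\<close>.\<close>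

definition geometric_category :: "'l rel \<Rightarrow> ('o, 'a) cat \<Rightarrow> bool" where
  "geometric_category r C \<longleftrightarrow>
    coherent_category C \<and>
    (\<forall>x \<in> Ob C. \<forall>S \<subseteq> monos_into C x. |S| <o r \<longrightarrow> has_stable_union C x S)"


section \<open>\<open>\<lambda>\<close>-pretoposes\<close>

definition is_equivalence_relation :: "('o, 'a) cat \<Rightarrow> 'o \<Rightarrow> 'a \<Rightarrow> 'a \<Rightarrow> bool" where
  "is_equivalence_relation C x r0 r1 \<longleftrightarrow>
    r0 \<in> Ar C \<and> r1 \<in> Ar C \<and> Dom C r0 = Dom C r1 \<and> Cod C r0 = x \<and> Cod C r1 = x \<and>
    \<comment> \<open>jointly monic\<close>
    (\<forall>f \<in> Ar C. \<forall>g \<in> Ar C.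
      Dom C f = Dom C g \<and> Cod C f = Dom C r0 \<and> Cod C g = Dom C r0 \<and>
      r0 \<cdot>\<^bsub>C\<^esub> f = r0 \<cdot>\<^bsub>C\<^esub> g \<and> r1 \<cdot>\<^bsub>C\<^esub> f = r1 \<cdot>\<^bsub>C\<^esub> g \<longrightarrow> f = g) \<and>
    \<comment> \<open>reflexive\<close>
    (\<exists>d \<in> hom C x (Dom C r0). r0 \<cdot>\<^bsub>C\<^esub> d = ident C x \<and> r1 \<cdot>\<^bsub>C\<^esub> d = ident C x) \<and>
    \<comment> \<open>symmetric\<close>
    (\<exists>s \<in> hom C (Dom C r0) (Dom C r0). r0 \<cdot>\<^bsub>C\<^esub> s = r1 \<and> r1 \<cdot>\<^bsub>C\<^esub> s = r0) \<and>
    \<comment> \<open>transitive\<close>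
    (\<forall>p q. is_pullback C r1 r0 p q \<longrightarrow>
      (\<exists>t \<in> hom C (Dom C p) (Dom C r0).
        r0 \<cdot>\<^bsub>C\<^esub> t = r0 \<cdot>\<^bsub>C\<^esub> p \<and> r1 \<cdot>\<^bsub>C\<^esub> t = r1 \<cdot>\<^bsub>C\<^esub> q))"

definition barr_exact_category :: "('o, 'a) cat \<Rightarrow> bool" where
  "barr_exact_category C \<longleftrightarrow>
    regular_category C \<and>
    (\<forall>x \<in> Ob C. \<forall>r0 r1. is_equivalence_relation C x r0 r1 \<longrightarrow>
      (\<exists>e. is_coequalizer C r0 r1 e \<and> is_pullback C e e r0 r1))"

definition is_coproduct ::
    "('o, 'a) cat \<Rightarrow> 'i set \<Rightarrow> ('i \<Rightarrow> 'o) \<Rightarrow> 'o \<Rightarrow> ('i \<Rightarrow> 'a) \<Rightarrow> bool" where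
  "is_coproduct C I A s inc \<longleftrightarrow>
    s \<in> Ob C \<and>
    (\<forall>i \<in> I. inc i \<in> hom C (A i) s) \<and>
    (\<forall>y \<in> Ob C. \<forall>g. (\<forall>i \<in> I. g i \<in> hom C (A i) y) \<longrightarrow>
      (\<exists>!h. h \<in> hom C s y \<and> (\<forall>i \<in> I. h \<cdot>\<^bsub>C\<^esub> inc i = g i)))"

definition disjoint_injections :: "('o, 'a) cat \<Rightarrow> 'i set \<Rightarrow> ('i \<Rightarrow> 'a) \<Rightarrow> bool" where
  "disjoint_injections C I inc \<longleftrightarrow>
    (\<forall>i \<in> I. is_mono C (inc i)) \<and>
    (\<forall>i \<in> I. \<forall>j \<in> I. \<forall>p q. i \<noteq> j \<and> is_pullback C (inc i) (inc j) p q \<longrightarrow>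
      is_initial C (Dom C p))"

definition stable_coproduct :: "('o, 'a) cat \<Rightarrow> 'i set \<Rightarrow> 'o \<Rightarrow> ('i \<Rightarrow> 'a) \<Rightarrow> bool" where
  "stable_coproduct C I s inc \<longleftrightarrow>
    (\<forall>f \<in> Ar C. \<forall>p q. Cod C f = s \<and> (\<forall>i \<in> I. is_pullback C f (inc i) (p i) (q i)) \<longrightarrow>
      is_coproduct C I (\<lambda>i. Dom C (p i)) (Dom C f) p)"

text \<open>Every set of cardinality below \<open>r\<close> is equinumerous to a subset of the field of \<open>r\<close>, so
  index sets taken from the type underlying \<open>r\<close> account for all coproducts of size below \<open>r\<close>.\<close>

definition pretopos :: "'l rel \<Rightarrow> ('o, 'a) cat \<Rightarrow> bool" where
  "pretopos r C \<longleftrightarrow>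
    geometric_category r C \<and>
    barr_exact_category C \<and>
    (\<forall>(I :: 'l set) A. |I| <o r \<and> (\<forall>i \<in> I. A i \<in> Ob C) \<longrightarrow>
      (\<exists>s inc. is_coproduct C I A s inc \<and>
        disjoint_injections C I inc \<and> stable_coproduct C I s inc))"


section \<open>Commutation of colimits with limits\<close>

text \<open>The functor \<open>L = lim\<^sub>K F : J \<rightarrow> C\<close> with projections \<open>\<pi> j k : L j \<rightarrow> F(j, k)\<close>; naturality of
  \<open>\<pi>\<close> in \<open>j\<close> determines the action of \<open>L\<close> on arrows.\<close>

definition is_limit_functor ::
    "('i, 'j) cat \<Rightarrow> ('k, 'n) cat \<Rightarrow> ('o, 'a) cat \<Rightarrow> ('i \<times> 'k, 'j \<times> 'n, 'o, 'a) func
      \<Rightarrow> ('i, 'j, 'o, 'a) func \<Rightarrow> ('i \<Rightarrow> 'k \<Rightarrow> 'a) \<Rightarrow> bool" where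
  "is_limit_functor J K C F L \<pi> \<longleftrightarrow>
    is_functor J C L \<and>
    (\<forall>j \<in> Ob J. is_limit K C (fix_fst J F j) (ob L j) (\<pi> j)) \<and>
    (\<forall>f \<in> Ar J. \<forall>k \<in> Ob K.
      ar F (f, ident K k) \<cdot>\<^bsub>C\<^esub> \<pi> (Dom J f) k = \<pi> (Cod J f) k \<cdot>\<^bsub>C\<^esub> ar L f)"

text \<open>Dually \<open>M = colim\<^sub>J F : K \<rightarrow> C\<close> with coprojections \<open>\<iota> j k : F(j, k) \<rightarrow> M k\<close>.\<close>

definition is_colimit_functor ::
    "('i, 'j) cat \<Rightarrow> ('k, 'n) cat \<Rightarrow> ('o, 'a) cat \<Rightarrow> ('i \<times> 'k, 'j \<times> 'n, 'o, 'a) func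
      \<Rightarrow> ('k, 'n, 'o, 'a) func \<Rightarrow> ('i \<Rightarrow> 'k \<Rightarrow> 'a) \<Rightarrow> bool" where
  "is_colimit_functor J K C F M \<iota> \<longleftrightarrow>
    is_functor K C M \<and>
    (\<forall>k \<in> Ob K. is_colimit J C (fix_snd K F k) (ob M k) (\<lambda>j. \<iota> j k)) \<and>
    (\<forall>g \<in> Ar K. \<forall>j \<in> Ob J.
      ar M g \<cdot>\<^bsub>C\<^esub> \<iota> j (Dom K g) = \<iota> j (Cod K g) \<cdot>\<^bsub>C\<^esub> ar F (ident J j, g))"

text \<open>The canonical morphism \<open>colim\<^sub>J lim\<^sub>K F \<rightarrow> lim\<^sub>K colim\<^sub>J F\<close> is the arrow \<open>\<kappa> : c \<rightarrow> l\<close>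
  singled out by the equations below (see \<open>comparison_ex1\<close>), where \<open>c\<close> with coprojections \<open>\<gamma> j\<close>
  is the colimit of \<open>L\<close>, and \<open>l\<close> with projections \<open>\<delta> k\<close> is the limit of \<open>M\<close>.\<close>

definition is_comparison ::
    "('i, 'j) cat \<Rightarrow> ('k, 'n) cat \<Rightarrow> ('o, 'a) cat \<Rightarrow> ('i \<Rightarrow> 'k \<Rightarrow> 'a) \<Rightarrow> ('i \<Rightarrow> 'k \<Rightarrow> 'a)
      \<Rightarrow> 'o \<Rightarrow> ('i \<Rightarrow> 'a) \<Rightarrow> 'o \<Rightarrow> ('k \<Rightarrow> 'a) \<Rightarrow> 'a \<Rightarrow> bool" where
  "is_comparison J K C \<pi> \<iota> c \<gamma> l \<delta> \<kappa> \<longleftrightarrow>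
    \<kappa> \<in> hom C c l \<and>
    (\<forall>j \<in> Ob J. \<forall>k \<in> Ob K. \<delta> k \<cdot>\<^bsub>C\<^esub> (\<kappa> \<cdot>\<^bsub>C\<^esub> \<gamma> j) = \<iota> j k \<cdot>\<^bsub>C\<^esub> \<pi> j k)"

definition colimits_commute_with_limits ::
    "('i, 'j) cat \<Rightarrow> ('k, 'n) cat \<Rightarrow> ('o, 'a) cat \<Rightarrow> bool" where
  "colimits_commute_with_limits J K C \<longleftrightarrow>
    (\<forall>F L \<pi> M \<iota> c \<gamma> l \<delta>.
      is_functor (prod_cat J K) C F \<and>
      is_limit_functor J K C F L \<pi> \<and>
      is_colimit_functor J K C F M \<iota> \<and>
      is_colimit J C L c \<gamma> \<and>
      is_limit K C M l \<delta> \<longrightarrow>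
      (\<exists>\<kappa>. is_comparison J K C \<pi> \<iota> c \<gamma> l \<delta> \<kappa> \<and> is_iso C \<kappa>))"

lemma comparison_ex1:
  assumes "category C" and J: "category J" and K: "category K"
    and F: "is_functor (prod_cat J K) C F"
    and L: "is_limit_functor J K C F L \<pi>"
    and M: "is_colimit_functor J K C F M \<iota>"
    and c: "is_colimit J C L c \<gamma>"
    and l: "is_limit K C M l \<delta>"
  shows "\<exists>!\<kappa>. is_comparison J K C \<pi> \<iota> c \<gamma> l \<delta> \<kappa>"
proof -
  interpret C: category C by fact
  interpret J: category J by fact
  interpret K: category K by fact
  have \<pi>: "\<pi> j k \<in> hom C (ob L j) (ob F (j,k))" if "j \<in> Ob J" "k \<in> Ob K" for j k
    using L that unfolding is_limit_functor_def is_limit_def is_cone_def fix_fst_def by simp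
  have \<pi>2: "ar F (ident J j, g) \<cdot>\<^bsub>C\<^esub> \<pi> j (Dom K g) = \<pi> j (Cod K g)" if "j \<in> Ob J" "g \<in> Ar K" for j g
    using L that unfolding is_limit_functor_def is_limit_def is_cone_def fix_fst_def by simp
  have \<iota>: "\<iota> j k \<in> hom C (ob F (j,k)) (ob M k)" if "j \<in> Ob J" "k \<in> Ob K" for j k
    using M that unfolding is_colimit_functor_def is_colimit_def is_cocone_def fix_snd_def by simp
  have \<iota>2: "\<iota> (Cod J f) k \<cdot>\<^bsub>C\<^esub> ar F (f, ident K k) = \<iota> (Dom J f) k" if "f \<in> Ar J" "k \<in> Ob K" for f k
    using M that unfolding is_colimit_functor_def is_colimit_def is_cocone_def fix_snd_def by simp
  have \<delta>: "\<delta> k \<in> hom C l (ob M k)" if "k \<in> Ob K" for k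
    using l that unfolding is_limit_def is_cone_def by simp
  have \<gamma>: "\<gamma> j \<in> hom C (ob L j) c" if "j \<in> Ob J" for j
    using c that unfolding is_colimit_def is_cocone_def by simp
  have Lf: "ar L f \<in> hom C (ob L (Dom J f)) (ob L (Cod J f))" if "f \<in> Ar J" for f
    using L that unfolding is_limit_functor_def is_functor_def by simp
  have Lo: "ob L j \<in> Ob C" if "j \<in> Ob J" for j
    using L that unfolding is_limit_functor_def is_functor_def by simp
  have Mg: "ar M g \<in> hom C (ob M (Dom K g)) (ob M (Cod K g))" if "g \<in> Ar K" for g
    using M that unfolding is_colimit_functor_def is_functor_def by simp
  have F1: "ar F (f, g) \<in> hom C (ob F (Dom J f, Dom K g)) (ob F (Cod J f, Cod K g))"
    if "f \<in> Ar J" "g \<in> Ar K" for f g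
    using F that unfolding is_functor_def prod_cat_def by auto
  have idJ: "ident J j \<in> Ar J \<and> Dom J (ident J j) = j \<and> Cod J (ident J j) = j" if "j \<in> Ob J" for j
    using J.ident_in_hom[OF that] by (simp add: hom_def)
  have idK: "ident K k \<in> Ar K \<and> Dom K (ident K k) = k \<and> Cod K (ident K k) = k" if "k \<in> Ob K" for k
    using K.ident_in_hom[OF that] by (simp add: hom_def)
  have u: "\<exists>!h. h \<in> hom C (ob L j) l \<and> (\<forall>k \<in> Ob K. \<delta> k \<cdot>\<^bsub>C\<^esub> h = \<iota> j k \<cdot>\<^bsub>C\<^esub> \<pi> j k)"
    if j: "j \<in> Ob J" for j
  proof -
    have "is_cone K C M (ob L j) (\<lambda>k. \<iota> j k \<cdot>\<^bsub>C\<^esub> \<pi> j k)"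
      unfolding is_cone_def
    proof (intro conjI ballI)
      show "ob L j \<in> Ob C" by (rule Lo[OF j])
      show "\<iota> j k \<cdot>\<^bsub>C\<^esub> \<pi> j k \<in> hom C (ob L j) (ob M k)" if "k \<in> Ob K" for k
        using C.cmp_in_hom \<pi>[OF j that] \<iota>[OF j that] by blast
      fix g assume g: "g \<in> Ar K"
      note gd = K.Dom_in_Ob[OF g] and gc = K.Cod_in_Ob[OF g]
      have Fg: "ar F (ident J j, g) \<in> hom C (ob F (j, Dom K g)) (ob F (j, Cod K g))"
        using F1[of "ident J j" g] idJ[OF j] g by simp
      have "ar M g \<cdot>\<^bsub>C\<^esub> (\<iota> j (Dom K g) \<cdot>\<^bsub>C\<^esub> \<pi> j (Dom K g)) =
          (ar M g \<cdot>\<^bsub>C\<^esub> \<iota> j (Dom K g)) \<cdot>\<^bsub>C\<^esub> \<pi> j (Dom K g)"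
        using C.cmp_assoc[OF \<pi>[OF j gd] \<iota>[OF j gd] Mg[OF g]] by simp
      also have "\<dots> = (\<iota> j (Cod K g) \<cdot>\<^bsub>C\<^esub> ar F (ident J j, g)) \<cdot>\<^bsub>C\<^esub> \<pi> j (Dom K g)"
        using M g j unfolding is_colimit_functor_def by simp
      also have "\<dots> = \<iota> j (Cod K g) \<cdot>\<^bsub>C\<^esub> \<pi> j (Cod K g)"
        using C.cmp_assoc[OF \<pi>[OF j gd] Fg \<iota>[OF j gc]] \<pi>2[OF j g] by simp
      finally show "ar M g \<cdot>\<^bsub>C\<^esub> (\<iota> j (Dom K g) \<cdot>\<^bsub>C\<^esub> \<pi> j (Dom K g)) =
          \<iota> j (Cod K g) \<cdot>\<^bsub>C\<^esub> \<pi> j (Cod K g)" .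
    qed
    with l show ?thesis unfolding is_limit_def by blast
  qed
  define \<phi> where "\<phi> j = (THE h. h \<in> hom C (ob L j) l \<and> (\<forall>k \<in> Ob K. \<delta> k \<cdot>\<^bsub>C\<^esub> h = \<iota> j k \<cdot>\<^bsub>C\<^esub> \<pi> j k))" for j
  have \<phi>: "\<phi> j \<in> hom C (ob L j) l" "\<And>k. k \<in> Ob K \<Longrightarrow> \<delta> k \<cdot>\<^bsub>C\<^esub> \<phi> j = \<iota> j k \<cdot>\<^bsub>C\<^esub> \<pi> j k"
    if "j \<in> Ob J" for j
    using theI'[OF u[OF that]] unfolding \<phi>_def by auto
  have "is_cocone J C L l \<phi>"
    unfolding is_cocone_def
  proof (intro conjI ballI)
    show "l \<in> Ob C" using l unfolding is_limit_def is_cone_def by simp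
    show "\<phi> j \<in> hom C (ob L j) l" if "j \<in> Ob J" for j by (rule \<phi>(1)[OF that])
    fix f assume f: "f \<in> Ar J"
    note fd = J.Dom_in_Ob[OF f] and fc = J.Cod_in_Ob[OF f]
    have "\<phi> (Cod J f) \<cdot>\<^bsub>C\<^esub> ar L f \<in> hom C (ob L (Dom J f)) l"
      using C.cmp_in_hom[OF Lf[OF f] \<phi>(1)[OF fc]] .
    moreover have "\<delta> k \<cdot>\<^bsub>C\<^esub> (\<phi> (Cod J f) \<cdot>\<^bsub>C\<^esub> ar L f) = \<iota> (Dom J f) k \<cdot>\<^bsub>C\<^esub> \<pi> (Dom J f) k"
      if k: "k \<in> Ob K" for k
    proof -
      have Ff: "ar F (f, ident K k) \<in> hom C (ob F (Dom J f, k)) (ob F (Cod J f, k))"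
        using F1[of f "ident K k"] idK[OF k] f by simp
      have nat: "ar F (f, ident K k) \<cdot>\<^bsub>C\<^esub> \<pi> (Dom J f) k = \<pi> (Cod J f) k \<cdot>\<^bsub>C\<^esub> ar L f"
        using L f k unfolding is_limit_functor_def by simp
      have "\<delta> k \<cdot>\<^bsub>C\<^esub> (\<phi> (Cod J f) \<cdot>\<^bsub>C\<^esub> ar L f) = (\<iota> (Cod J f) k \<cdot>\<^bsub>C\<^esub> \<pi> (Cod J f) k) \<cdot>\<^bsub>C\<^esub> ar L f"
        using C.cmp_assoc[OF Lf[OF f] \<phi>(1)[OF fc] \<delta>[OF k]] \<phi>(2)[OF fc k] by simp
      also have "\<dots> = \<iota> (Cod J f) k \<cdot>\<^bsub>C\<^esub> (ar F (f, ident K k) \<cdot>\<^bsub>C\<^esub> \<pi> (Dom J f) k)"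
        using C.cmp_assoc[OF Lf[OF f] \<pi>[OF fc k] \<iota>[OF fc k]] nat by simp
      also have "\<dots> = \<iota> (Dom J f) k \<cdot>\<^bsub>C\<^esub> \<pi> (Dom J f) k"
        using C.cmp_assoc[OF \<pi>[OF fd k] Ff \<iota>[OF fc k]] \<iota>2[OF f k] by simp
      finally show ?thesis .
    qed
    ultimately show "\<phi> (Cod J f) \<cdot>\<^bsub>C\<^esub> ar L f = \<phi> (Dom J f)"
      using u[OF fd] \<phi>[OF fd] by blast
  qed
  with c have ex: "\<exists>!h. h \<in> hom C c l \<and> (\<forall>j \<in> Ob J. h \<cdot>\<^bsub>C\<^esub> \<gamma> j = \<phi> j)"
    unfolding is_colimit_def by blast
  have "is_comparison J K C \<pi> \<iota> c \<gamma> l \<delta> h \<longleftrightarrow>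
      h \<in> hom C c l \<and> (\<forall>j \<in> Ob J. h \<cdot>\<^bsub>C\<^esub> \<gamma> j = \<phi> j)" for h
  proof
    assume h: "is_comparison J K C \<pi> \<iota> c \<gamma> l \<delta> h"
    then have hc: "h \<in> hom C c l" unfolding is_comparison_def by simp
    have "h \<cdot>\<^bsub>C\<^esub> \<gamma> j = \<phi> j" if j: "j \<in> Ob J" for j
    proof -
      have "\<forall>k \<in> Ob K. \<delta> k \<cdot>\<^bsub>C\<^esub> (h \<cdot>\<^bsub>C\<^esub> \<gamma> j) = \<iota> j k \<cdot>\<^bsub>C\<^esub> \<pi> j k"
        using h j unfolding is_comparison_def by simp
      with C.cmp_in_hom[OF \<gamma>[OF j] hc] show ?thesis
        using u[OF j] \<phi>[OF j] by blast
    qed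
    with hc show "h \<in> hom C c l \<and> (\<forall>j \<in> Ob J. h \<cdot>\<^bsub>C\<^esub> \<gamma> j = \<phi> j)" by simp
  next
    assume "h \<in> hom C c l \<and> (\<forall>j \<in> Ob J. h \<cdot>\<^bsub>C\<^esub> \<gamma> j = \<phi> j)"
    then show "is_comparison J K C \<pi> \<iota> c \<gamma> l \<delta> h"
      unfolding is_comparison_def using \<phi>(2) by simp
  qed
  with ex show ?thesis by simp
qed

end

theory Submission
  imports Defs
begin

text \<open>
  In the category of sets, filtered colimits commute with finite limits because of two facts about
  a filtered colimit: every element comes from some stage, and two elements of a stage become
  equal in the colimit only if they already become equal at a later stage. The proof below runs
  this argument in a \<open>\<lambda>\<close>-pretopos, with generalised elements \<open>T \<rightarrow> X\<close> in place of elements and with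
  existence understood locally, that is, after passing to a cover of \<open>T\<close> by fewer than \<open>\<lambda>\<close> arrows.

  Covers are jointly extremal epimorphic families, those that factor through no proper subobject.
  The predicate \<open>locally T P\<close> says that \<open>P\<close> holds on a cover. Pullback-stable images and unions make
  it stable under restriction (\<open>locally_pullback\<close>), regularity of \<open>\<lambda>\<close> makes it transitive
  (\<open>locally_bind\<close>), and two properties descend from a cover: factoring through a monomorphism
  (\<open>locally_factor\<close>) and equality of arrows (\<open>locally_separated\<close>).

  Every element of a colimit comes locally from a stage (\<open>locally_in_stage\<close>): a subobject containing
  all stages receives the colimit. The converse control over equality (\<open>colimit_identifies\<close>) is
  where the pretopos structure enters. On the coproduct \<open>s\<close> of the stages, call two elements related
  if locally they lie in summands and are identified by arrows of the diagram. This is an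
  equivalence relation, where transitivity uses filteredness and disjointness of the coproduct, and
  it is represented by a subobject of \<open>s \<times> s\<close>, a union of images of fibre products
  (\<open>relation_representable\<close>). Exactness gives a quotient of \<open>s\<close> whose kernel pair is this relation.
  The quotient map restricts to a cocone on the diagram, so an equality in the colimit maps to an
  equality in the quotient, and hence comes from arrows of the diagram.

  For the comparison \<open>\<kappa>\<close>, the set-theoretic argument then applies. An element of \<open>lim colim\<close> is a
  matching family; its finitely many entries lift to one stage, and the finitely many matching
  conditions hold at a later one, so that it comes locally from some \<open>lim F(j, -)\<close>
  (\<open>locally_lift_limit\<close>). Similarly elements of \<open>colim lim\<close> with equal images under \<open>\<kappa>\<close> are locally equal
  (\<open>identified_in_colimit\<close>). So \<open>\<kappa>\<close> is a monomorphism through which the identity of its codomain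
  factors locally, hence globally, and it is invertible.
\<close>

section \<open>Arrows, pullbacks and monomorphisms\<close>

context category
begin

lemma cmp_Ar [simp]: "\<lbrakk>f \<in> Ar C; g \<in> Ar C; Dom C g = Cod C f\<rbrakk> \<Longrightarrow> g \<cdot> f \<in> Ar C"
  and Dom_cmp [simp]: "\<lbrakk>f \<in> Ar C; g \<in> Ar C; Dom C g = Cod C f\<rbrakk> \<Longrightarrow> Dom C (g \<cdot> f) = Dom C f"
  and Cod_cmp [simp]: "\<lbrakk>f \<in> Ar C; g \<in> Ar C; Dom C g = Cod C f\<rbrakk> \<Longrightarrow> Cod C (g \<cdot> f) = Cod C g"
  using cmp_in_hom[of f "Dom C f" "Cod C f" g "Cod C g"] by (auto simp: hom_def)

lemma cmp_assoc' [simp]: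
  "\<lbrakk>f \<in> Ar C; g \<in> Ar C; h \<in> Ar C; Dom C g = Cod C f; Dom C h = Cod C g\<rbrakk>
    \<Longrightarrow> (h \<cdot> g) \<cdot> f = h \<cdot> (g \<cdot> f)"
  using cmp_assoc[of f "Dom C f" "Cod C f" g "Cod C g" h "Cod C h"] by (auto simp: hom_def)

lemma ident_simps [simp]:
  assumes "x \<in> Ob C"
  shows "ident C x \<in> Ar C" "Dom C (ident C x) = x" "Cod C (ident C x) = x"
  using ident_in_hom[OF assms] by (auto simp: hom_def)

lemma cmp_ident [simp]:
  "\<lbrakk>f \<in> Ar C; Dom C f = x\<rbrakk> \<Longrightarrow> f \<cdot> ident C x = f"
  "\<lbrakk>f \<in> Ar C; Cod C f = x\<rbrakk> \<Longrightarrow> ident C x \<cdot> f = f"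
  using cmp_ident_right[of f x "Cod C f"] cmp_ident_left[of f "Dom C f" x]
  by (auto simp: hom_def)

declare Dom_in_Ob [simp] Cod_in_Ob [simp]

lemma cmp_extend:
  assumes "f \<cdot> p = g \<cdot> q"
    and "f \<in> Ar C" "g \<in> Ar C" "p \<in> Ar C" "q \<in> Ar C" "k \<in> Ar C"
    and "Dom C f = Cod C p" "Dom C g = Cod C q" "Dom C p = Cod C k" "Dom C q = Cod C k"
  shows "f \<cdot> (p \<cdot> k) = g \<cdot> (q \<cdot> k)"
  using assms by (metis cmp_assoc')

lemma mono_cancel:
  assumes "is_mono C m" "m \<cdot> f = m \<cdot> g"
    and "f \<in> Ar C" "g \<in> Ar C" "Dom C f = Dom C g" "Cod C f = Dom C m" "Cod C g = Dom C m"
  shows "f = g"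
  using assms unfolding is_mono_def by blast

lemma mono_cmp:
  assumes m: "is_mono C m" and n: "is_mono C n" and d: "Dom C m = Cod C n"
  shows "is_mono C (m \<cdot> n)"
proof -
  have [simp]: "m \<in> Ar C" "n \<in> Ar C" using m n by (auto simp: is_mono_def)
  show ?thesis
    unfolding is_mono_def
  proof (intro conjI ballI impI)
    show "m \<cdot> n \<in> Ar C" using d by simp
    fix f g assume fg: "f \<in> Ar C" "g \<in> Ar C"
      "Dom C f = Dom C g \<and> Cod C f = Dom C (m \<cdot> n) \<and> Cod C g = Dom C (m \<cdot> n) \<and> (m \<cdot> n) \<cdot> f = (m \<cdot> n) \<cdot> g"
    then have "n \<cdot> f = n \<cdot> g" using d by - (rule mono_cancel[OF m], auto)
    then show "f = g" using fg d by - (rule mono_cancel[OF n], auto)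
  qed
qed

lemma pullback_simps:
  assumes "is_pullback C f g p q"
  shows "f \<in> Ar C" "g \<in> Ar C" "p \<in> Ar C" "q \<in> Ar C" "Cod C g = Cod C f" "Dom C q = Dom C p"
    "Cod C p = Dom C f" "Cod C q = Dom C g" "f \<cdot> p = g \<cdot> q"
  using assms by (auto simp: is_pullback_def)

lemma pullback_lift:
  assumes "is_pullback C f g p q" "a \<in> Ar C" "b \<in> Ar C"
    and "Dom C b = Dom C a" "Cod C a = Dom C f" "Cod C b = Dom C g" "f \<cdot> a = g \<cdot> b"
  obtains h where "h \<in> Ar C" "Dom C h = Dom C a" "Cod C h = Dom C p" "p \<cdot> h = a" "q \<cdot> h = b"
  using assms unfolding is_pullback_def hom_def by (smt (verit) mem_Collect_eq)

lemma pullback_unique: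
  assumes "is_pullback C f g p q" "h \<in> Ar C" "k \<in> Ar C" "Dom C h = Dom C k"
    and "Cod C h = Dom C p" "Cod C k = Dom C p" "p \<cdot> h = p \<cdot> k" "q \<cdot> h = q \<cdot> k"
  shows "h = k"
proof -
  note [simp] = pullback_simps(1-8)[OF assms(1)]
  have "f \<cdot> (p \<cdot> k) = g \<cdot> (q \<cdot> k)"
    using assms by - (rule cmp_extend[OF pullback_simps(9)[OF assms(1)]], auto)
  moreover have "p \<cdot> k \<in> Ar C" "q \<cdot> k \<in> Ar C" using assms by auto
  moreover have "Dom C (p \<cdot> k) = Dom C k" "Dom C (q \<cdot> k) = Dom C k"
    "Cod C (p \<cdot> k) = Dom C f" "Cod C (q \<cdot> k) = Dom C g" using assms by auto
  ultimately have "\<exists>!x. x \<in> hom C (Dom C k) (Dom C p) \<and> p \<cdot> x = p \<cdot> k \<and> q \<cdot> x = q \<cdot> k"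
    using assms(1) unfolding is_pullback_def by metis
  then show ?thesis using assms by (auto simp: hom_def)
qed

lemma pullback_of_mono:
  assumes pb: "is_pullback C f m p q" and m: "is_mono C m"
  shows "is_mono C p"
  unfolding is_mono_def
proof (intro conjI ballI impI)
  note [simp] = pullback_simps(1-8)[OF pb]
  show "p \<in> Ar C" by simp
  fix a b assume ab: "a \<in> Ar C" "b \<in> Ar C"
    "Dom C a = Dom C b \<and> Cod C a = Dom C p \<and> Cod C b = Dom C p \<and> p \<cdot> a = p \<cdot> b"
  have "f \<cdot> (p \<cdot> a) = m \<cdot> (q \<cdot> a)" "f \<cdot> (p \<cdot> b) = m \<cdot> (q \<cdot> b)"
    using ab by - (rule cmp_extend[OF pullback_simps(9)[OF pb]], auto)+
  then have "m \<cdot> (q \<cdot> a) = m \<cdot> (q \<cdot> b)" using ab by simp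
  then have "q \<cdot> a = q \<cdot> b" using ab by - (rule mono_cancel[OF m], auto)
  then show "a = b" using ab by - (rule pullback_unique[OF pb], auto)
qed

lemma sub_leI: "\<lbrakk>f = m \<cdot> h; h \<in> Ar C; Dom C h = Dom C f; Cod C h = Dom C m\<rbrakk> \<Longrightarrow> sub_le C f m"
  by (auto simp: sub_le_def hom_def)

lemma sub_leE:
  assumes "sub_le C f m"
  obtains h where "f = m \<cdot> h" "h \<in> Ar C" "Dom C h = Dom C f" "Cod C h = Dom C m"
  using assms by (auto simp: sub_le_def hom_def)

lemma sub_le_trans:
  assumes "sub_le C f m" "sub_le C m n" "n \<in> Ar C"
  shows "sub_le C f n"
proof -
  obtain h where h: "f = m \<cdot> h" "h \<in> Ar C" "Dom C h = Dom C f" "Cod C h = Dom C m"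
    using assms(1) by (rule sub_leE)
  obtain k where k: "m = n \<cdot> k" "k \<in> Ar C" "Dom C k = Dom C m" "Cod C k = Dom C n"
    using assms(2) by (rule sub_leE)
  have "f = (n \<cdot> k) \<cdot> h" using h(1) k(1) by metis
  also have "\<dots> = n \<cdot> (k \<cdot> h)" using h(2-4) k(2-4) assms(3) by simp
  finally show ?thesis using h k by (intro sub_leI[of _ _ "k \<cdot> h"]) auto
qed

lemma sub_le_cmp:
  assumes "sub_le C f m" and m: "m \<in> Ar C" and g: "g \<in> Ar C" "Cod C g = Dom C f"
  shows "sub_le C (f \<cdot> g) m"
proof -
  obtain h where h: "f = m \<cdot> h" "h \<in> Ar C" "Dom C h = Dom C f" "Cod C h = Dom C m"
    using assms(1) by (rule sub_leE)
  have "f \<cdot> g = (m \<cdot> h) \<cdot> g" using h(1) by metis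
  also have "\<dots> = m \<cdot> (h \<cdot> g)" using h(2-4) m g by simp
  finally have "f \<cdot> g = m \<cdot> (h \<cdot> g)" .
  moreover have "f \<in> Ar C" using h m by (metis cmp_Ar)
  ultimately show ?thesis
    using h(2-4) m g by (intro sub_leI[of _ _ "h \<cdot> g"]) auto
qed

lemma mono_split_iso:
  assumes m: "is_mono C m" and s: "sub_le C (ident C (Cod C m)) m"
  shows "is_iso C m"
proof -
  have [simp]: "m \<in> Ar C" using m by (simp add: is_mono_def)
  obtain h where h: "ident C (Cod C m) = m \<cdot> h" "h \<in> Ar C"
      "Dom C h = Dom C (ident C (Cod C m))" "Cod C h = Dom C m"
    using s by (rule sub_leE)
  have "m \<cdot> (h \<cdot> m) = m \<cdot> ident C (Dom C m)"
    using h(2-4) by (metis Cod_in_Ob cmp_assoc' cmp_ident \<open>m \<in> Ar C\<close> h(1) ident_simps(2))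
  then have "h \<cdot> m = ident C (Dom C m)"
    using h(2-4) by - (rule mono_cancel[OF m], auto)
  then show ?thesis
    using h(2-4) h(1)[symmetric] by (auto simp: is_iso_def hom_def intro!: bexI[of _ h])
qed

text \<open>If \<open>e = m \<cdot> h\<close> with \<open>m\<close> monic, then \<open>h\<close> coequalises every pair that \<open>e\<close> does; so \<open>h\<close> descends
  along \<open>e\<close>, and the descended arrow is a section of \<open>m\<close>.\<close>

lemma regular_epi_extremal:
  assumes e: "is_regular_epi C e" and m: "is_mono C m" and le: "sub_le C e m" and c: "Cod C m = Cod C e"
  shows "sub_le C (ident C (Cod C e)) m"
proof -
  obtain a b where ce: "is_coequalizer C a b e" using e by (auto simp: is_regular_epi_def)
  then have [simp]: "a \<in> Ar C" "b \<in> Ar C" "e \<in> Ar C" "Dom C a = Dom C b" "Cod C a = Cod C b"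
      "Dom C e = Cod C b" and ab: "e \<cdot> a = e \<cdot> b"
    by (auto simp: is_coequalizer_def)
  have univ: "\<exists>!h. h \<in> hom C (Cod C e) (Cod C x) \<and> h \<cdot> e = x"
    if "x \<in> Ar C" "Dom C x = Cod C b" "x \<cdot> a = x \<cdot> b" for x
    using ce that by (auto simp: is_coequalizer_def)
  have [simp]: "m \<in> Ar C" using m by (simp add: is_mono_def)
  obtain h where h: "e = m \<cdot> h" "h \<in> Ar C" "Dom C h = Dom C e" "Cod C h = Dom C m"
    using le by (rule sub_leE)
  have h3: "Dom C h = Cod C b" using h(3) by simp
  have "m \<cdot> (h \<cdot> a) = m \<cdot> (h \<cdot> b)" using ab[unfolded h(1)] h(2,4) h3 by simp
  then have "h \<cdot> a = h \<cdot> b" using h(2,4) h3 by - (rule mono_cancel[OF m], auto)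
  then obtain k where k: "k \<in> Ar C" "Dom C k = Cod C e" "Cod C k = Dom C m" "k \<cdot> e = h"
    using univ[of h] h(2,4) h3 by (auto simp: hom_def)
  have "(m \<cdot> k) \<cdot> e = e" using k c h(1)[symmetric] by simp
  moreover have "m \<cdot> k \<in> hom C (Cod C e) (Cod C e)" using k c by (simp add: hom_def)
  moreover have "ident C (Cod C e) \<in> hom C (Cod C e) (Cod C e)" "ident C (Cod C e) \<cdot> e = e"
    by (simp_all add: hom_def)
  moreover have "\<exists>!h. h \<in> hom C (Cod C e) (Cod C e) \<and> h \<cdot> e = e" using univ[of e] ab by simp
  ultimately have "m \<cdot> k = ident C (Cod C e)" by metis
  then show ?thesis using k by (intro sub_leI[of _ _ k]) auto
qed

lemma limit_ext:
  assumes lim: "is_limit K C F x p" and F: "is_functor K C F" and K: "category K"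
    and h: "h \<in> Ar C" "Cod C h = x" and k: "k \<in> Ar C" "Cod C k = x" "Dom C k = Dom C h"
    and eq: "\<And>i. i \<in> Ob K \<Longrightarrow> p i \<cdot> h = p i \<cdot> k"
  shows "h = k"
proof -
  interpret K: category K by fact
  have p: "p i \<in> Ar C" "Dom C (p i) = x" "Cod C (p i) = ob F i" if "i \<in> Ob K" for i
    using lim that by (auto simp: is_limit_def is_cone_def hom_def)
  have nat: "ar F f \<cdot> p (Dom K f) = p (Cod K f)" if "f \<in> Ar K" for f
    using lim that by (auto simp: is_limit_def is_cone_def)
  have Ff: "ar F f \<in> Ar C" "Dom C (ar F f) = ob F (Dom K f)" if "f \<in> Ar K" for f
    using F that by (auto simp: is_functor_def hom_def)
  have "ar F f \<cdot> (p (Dom K f) \<cdot> h) = p (Cod K f) \<cdot> h" if "f \<in> Ar K" for f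
    using nat[OF that] p[of "Dom K f"] Ff[OF that] h that
    by (metis K.Dom_in_Ob cmp_assoc')
  then have "is_cone K C F (Dom C h) (\<lambda>i. p i \<cdot> h)"
    using h p by (auto simp: is_cone_def hom_def)
  then have "\<exists>!g. g \<in> hom C (Dom C h) x \<and> (\<forall>i \<in> Ob K. p i \<cdot> g = p i \<cdot> h)"
    using lim unfolding is_limit_def by blast
  moreover have "h \<in> hom C (Dom C h) x" "k \<in> hom C (Dom C h) x" using h k by (auto simp: hom_def)
  ultimately show ?thesis using eq by metis
qed

lemma colimit_ext:
  assumes col: "is_colimit J C F x p" and F: "is_functor J C F" and J: "category J"
    and h: "h \<in> Ar C" "Dom C h = x" and k: "k \<in> Ar C" "Dom C k = x" "Cod C k = Cod C h"
    and eq: "\<And>i. i \<in> Ob J \<Longrightarrow> h \<cdot> p i = k \<cdot> p i"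
  shows "h = k"
proof -
  interpret J: category J by fact
  have p: "p i \<in> Ar C" "Cod C (p i) = x" "Dom C (p i) = ob F i" if "i \<in> Ob J" for i
    using col that by (auto simp: is_colimit_def is_cocone_def hom_def)
  have nat: "p (Cod J f) \<cdot> ar F f = p (Dom J f)" if "f \<in> Ar J" for f
    using col that by (auto simp: is_colimit_def is_cocone_def)
  have Ff: "ar F f \<in> Ar C" "Cod C (ar F f) = ob F (Cod J f)" if "f \<in> Ar J" for f
    using F that by (auto simp: is_functor_def hom_def)
  have "is_cocone J C F (Cod C h) (\<lambda>i. h \<cdot> p i)"
    using h p Ff nat by (auto simp: is_cocone_def hom_def)
  then have "\<exists>!g. g \<in> hom C x (Cod C h) \<and> (\<forall>i \<in> Ob J. g \<cdot> p i = h \<cdot> p i)"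
    using col unfolding is_colimit_def by blast
  moreover have "h \<in> hom C x (Cod C h)" "k \<in> hom C x (Cod C h)" using h k by (auto simp: hom_def)
  ultimately show ?thesis using eq by metis
qed

end


section \<open>Pullbacks, products and equalisers from finite limits\<close>

locale finitely_complete = category +
  assumes finite_limits: "has_finite_limits C"
begin

lemma pullback_exists:
  assumes [simp]: "f \<in> Ar C" "g \<in> Ar C" and fg: "Cod C f = Cod C g"
  obtains p q where "is_pullback C f g p q"
proof -
  \<comment> \<open>The walking cospan: identities 0, 1, 2 and arrows 3 from 0 to 2 and 4 from 1 to 2.\<close>
  define K :: "(nat, nat) cat" where "K =
    \<lparr> Ob = {0,1,2}, Ar = {0,1,2,3,4},
      Dom = (\<lambda>a. if a = 3 then 0 else if a = 4 then 1 else a),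
      Cod = (\<lambda>a. if a < 3 then a else 2), ident = (\<lambda>x. x),
      cmp = (\<lambda>b a. if a < 3 then b else a) \<rparr>"
  define F :: "(nat, nat, 'a, 'b) func" where "F =
    \<lparr> ob = (\<lambda>x. if x = 0 then Dom C f else if x = 1 then Dom C g else Cod C f),
      ar = (\<lambda>a. if a = 0 then ident C (Dom C f) else if a = 1 then ident C (Dom C g)
         else if a = 2 then ident C (Cod C f) else if a = 3 then f else g) \<rparr>"
  have "category K"
    by unfold_locales (auto simp: K_def hom_def)
  then have "finite_category K"
    by (simp add: finite_category_def) (simp add: K_def)
  moreover have "is_functor K C F"
    unfolding is_functor_def by (auto simp: K_def F_def hom_def fg)
  ultimately obtain x p where lim: "is_limit K C F x p"
    using finite_limits unfolding has_finite_limits_def by blast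
  have p: "p 0 \<in> Ar C" "p 1 \<in> Ar C" "p 2 \<in> Ar C" "Dom C (p 0) = x" "Dom C (p 1) = x"
      "Cod C (p 0) = Dom C f" "Cod C (p 1) = Dom C g" "f \<cdot> p 0 = p 2" "g \<cdot> p 1 = p 2"
    using lim unfolding is_limit_def is_cone_def by (auto simp: K_def F_def hom_def)
  have "is_pullback C f g (p 0) (p 1)"
    unfolding is_pullback_def
  proof (intro conjI ballI impI)
    fix a b assume ab: "a \<in> Ar C" "b \<in> Ar C"
      "Dom C a = Dom C b \<and> Cod C a = Dom C f \<and> Cod C b = Dom C g \<and> f \<cdot> a = g \<cdot> b"
    define q where "q n = (if n = 0 then a else if n = 1 then b else f \<cdot> a)" for n :: nat
    have "is_cone K C F (Dom C a) q"
      unfolding is_cone_def using ab by (auto simp: K_def F_def hom_def q_def fg)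
    then have *: "\<exists>!h. h \<in> hom C (Dom C a) x \<and> (\<forall>i \<in> Ob K. p i \<cdot> h = q i)"
      using lim unfolding is_limit_def by blast
    have "(\<forall>i \<in> Ob K. p i \<cdot> h = q i) \<longleftrightarrow> p 0 \<cdot> h = a \<and> p 1 \<cdot> h = b"
      if "h \<in> hom C (Dom C a) x" for h
      using that p(1-7) p(8)[symmetric] by (auto simp: K_def q_def hom_def)
    with * p show "\<exists>!h. h \<in> hom C (Dom C a) (Dom C (p 0)) \<and> p 0 \<cdot> h = a \<and> p 1 \<cdot> h = b"
      by (metis (no_types, lifting))
  qed (use p fg in auto)
  then show thesis by (rule that)
qed

lemma terminal_exists:
  obtains t where "t \<in> Ob C" "\<And>x. x \<in> Ob C \<Longrightarrow> \<exists>!h. h \<in> hom C x t"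
proof -
  define K :: "(nat, nat) cat" where "K =
    \<lparr> Ob = {}, Ar = {}, Dom = id, Cod = id, ident = id, cmp = (\<lambda>b a. a) \<rparr>"
  define F :: "(nat, nat, 'a, 'b) func" where "F = undefined"
  have "category K"
    by unfold_locales (auto simp: K_def hom_def)
  then have "finite_category K"
    by (simp add: finite_category_def) (simp add: K_def)
  moreover have "is_functor K C F"
    unfolding is_functor_def by (auto simp: K_def)
  ultimately obtain t p where "is_limit K C F t p"
    using finite_limits unfolding has_finite_limits_def by blast
  then show thesis
    by (intro that[of t]) (auto simp: is_limit_def is_cone_def K_def)
qed

lemma product_exists:
  assumes [simp]: "x \<in> Ob C" "y \<in> Ob C"
  obtains p q where "p \<in> Ar C" "q \<in> Ar C" "Dom C q = Dom C p" "Cod C p = x" "Cod C q = y"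
    and "\<And>a b. \<lbrakk>a \<in> Ar C; b \<in> Ar C; Dom C b = Dom C a; Cod C a = x; Cod C b = y\<rbrakk>
      \<Longrightarrow> \<exists>h \<in> Ar C. Dom C h = Dom C a \<and> Cod C h = Dom C p \<and> p \<cdot> h = a \<and> q \<cdot> h = b"
    and "\<And>h k. \<lbrakk>h \<in> Ar C; k \<in> Ar C; Dom C h = Dom C k; Cod C h = Dom C p; Cod C k = Dom C p;
      p \<cdot> h = p \<cdot> k; q \<cdot> h = q \<cdot> k\<rbrakk> \<Longrightarrow> h = k"
proof -
  obtain t where t: "t \<in> Ob C" "\<And>x. x \<in> Ob C \<Longrightarrow> \<exists>!h. h \<in> hom C x t"
    using terminal_exists by blast
  obtain f g where fg: "f \<in> hom C x t" "g \<in> hom C y t" using t(2) by (meson assms)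
  then have [simp]: "f \<in> Ar C" "g \<in> Ar C" "Dom C f = x" "Dom C g = y" "Cod C f = t" "Cod C g = t"
    by (auto simp: hom_def)
  obtain p q where pb: "is_pullback C f g p q" using pullback_exists[of f g] by auto
  note [simp] = pullback_simps(1-8)[OF pb, simplified]
  show thesis
  proof (rule that[of p q])
    fix a b assume ab: "a \<in> Ar C" "b \<in> Ar C" "Dom C b = Dom C a" "Cod C a = x" "Cod C b = y"
    have "f \<cdot> a \<in> hom C (Dom C a) t" "g \<cdot> b \<in> hom C (Dom C a) t" using ab by (auto simp: hom_def)
    then have "f \<cdot> a = g \<cdot> b" using t(2)[of "Dom C a"] ab by auto
    then show "\<exists>h \<in> Ar C. Dom C h = Dom C a \<and> Cod C h = Dom C p \<and> p \<cdot> h = a \<and> q \<cdot> h = b"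
      using ab pullback_lift[OF pb, of a b] by auto
  qed (auto intro: pullback_unique[OF pb])
qed

lemma equaliser_exists:
  assumes [simp]: "f \<in> Ar C" "g \<in> Ar C" and fg: "Dom C f = Dom C g" "Cod C f = Cod C g"
  obtains m where "is_mono C m" "Cod C m = Dom C f"
    and "\<And>u. \<lbrakk>u \<in> Ar C; Cod C u = Dom C f\<rbrakk> \<Longrightarrow> f \<cdot> u = g \<cdot> u \<longleftrightarrow> sub_le C u m"
proof -
  have o: "Dom C f \<in> Ob C" "Cod C f \<in> Ob C" by auto
  obtain p q where [simp]: "p \<in> Ar C" "q \<in> Ar C" "Dom C q = Dom C p" "Cod C p = Dom C f" "Cod C q = Cod C f"
    and pair: "\<And>a b. \<lbrakk>a \<in> Ar C; b \<in> Ar C; Dom C b = Dom C a; Cod C a = Dom C f; Cod C b = Cod C f\<rbrakk>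
      \<Longrightarrow> \<exists>h \<in> Ar C. Dom C h = Dom C a \<and> Cod C h = Dom C p \<and> p \<cdot> h = a \<and> q \<cdot> h = b"
    and uniq: "\<And>h k. \<lbrakk>h \<in> Ar C; k \<in> Ar C; Dom C h = Dom C k; Cod C h = Dom C p; Cod C k = Dom C p;
      p \<cdot> h = p \<cdot> k; q \<cdot> h = q \<cdot> k\<rbrakk> \<Longrightarrow> h = k"
    using product_exists[OF o] by blast
  \<comment> \<open>The equaliser is the intersection of the graphs of \<open>f\<close> and \<open>g\<close>.\<close>
  obtain a where a: "a \<in> Ar C" "Dom C a = Dom C f" "Cod C a = Dom C p" "p \<cdot> a = ident C (Dom C f)" "q \<cdot> a = f"
    using pair[of "ident C (Dom C f)" f, OF _ assms(1)] by (metis ident_simps o(1))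
  obtain b where b: "b \<in> Ar C" "Dom C b = Dom C f" "Cod C b = Dom C p" "p \<cdot> b = ident C (Dom C f)" "q \<cdot> b = g"
    using pair[of "ident C (Dom C f)" g, OF _ assms(2)] fg by (metis ident_simps o(1))
  obtain m n where pb: "is_pullback C a b m n" using pullback_exists[of a b] a b by auto
  note ms = pullback_simps[OF pb]
  have pa: "p \<cdot> (a \<cdot> u) = u" "p \<cdot> (b \<cdot> u) = u" if "u \<in> Ar C" "Cod C u = Dom C f" for u
    using that a b by (metis \<open>p \<in> Ar C\<close> cmp_assoc' cmp_ident(2))+
  have qa: "q \<cdot> (a \<cdot> u) = f \<cdot> u" "q \<cdot> (b \<cdot> u) = g \<cdot> u" if "u \<in> Ar C" "Cod C u = Dom C f" for u
    using that a b by (metis \<open>q \<in> Ar C\<close> \<open>Dom C q = Dom C p\<close> cmp_assoc')+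
  have mb: "is_mono C b"
    unfolding is_mono_def using b pa(2) by metis
  have "n = m" using ms pa a b by metis
  show thesis
  proof (rule that[of m])
    show "is_mono C m" using pb mb by (rule pullback_of_mono)
    show "Cod C m = Dom C f" using ms a by simp
    fix u assume u: "u \<in> Ar C" "Cod C u = Dom C f"
    show "f \<cdot> u = g \<cdot> u \<longleftrightarrow> sub_le C u m"
    proof
      assume "f \<cdot> u = g \<cdot> u"
      then have "a \<cdot> u = b \<cdot> u"
        using u a b pa[OF u] qa[OF u] by - (rule uniq, auto)
      then obtain h where "h \<in> Ar C" "Dom C h = Dom C u" "Cod C h = Dom C m" "m \<cdot> h = u"
        using u a b by - (rule pullback_lift[OF pb, of u u], auto simp: \<open>n = m\<close>)
      then show "sub_le C u m" by (intro sub_leI[of _ _ h]) auto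
    next
      assume "sub_le C u m"
      then obtain h where h: "u = m \<cdot> h" "h \<in> Ar C" "Dom C h = Dom C u" "Cod C h = Dom C m"
        by (rule sub_leE)
      have "a \<cdot> m = b \<cdot> m" using ms \<open>n = m\<close> by simp
      then have "f \<cdot> m = g \<cdot> m" using qa[of m] ms a by simp
      then show "f \<cdot> u = g \<cdot> u"
        unfolding h(1) using h(2-4) ms a fg by - (rule cmp_extend, auto)
    qed
  qed
qed

end


section \<open>Local truth in a geometric category\<close>

locale lambda_geometric = finitely_complete +
  fixes r :: "'l rel"
  assumes infinite_card: "Cinfinite r" and regular_card: "regularCard r"
    and geometric: "geometric_category r C"
begin

lemma small_image: "|A| <o r \<Longrightarrow> |f ` A| <o r"
  by (rule ordLeq_ordLess_trans[OF card_of_image])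

lemma small_UN: "\<lbrakk>|I| <o r; \<And>i. i \<in> I \<Longrightarrow> |A i| <o r\<rbrakk> \<Longrightarrow> |\<Union>i \<in> I. A i| <o r"
  using card_of_UNION_ordLess_infinite_Field_regularCard[OF regular_card infinite_card] by blast

lemma small_finite: "finite A \<Longrightarrow> |A| <o r"
  using infinite_card unfolding cinfinite_def
  by (intro finite_ordLess_infinite) (auto simp: card_order_on_def Field_card_of card_of_well_order_on)

lemma small_Times:
  assumes "|A| <o r" "|B| <o r"
  shows "|A \<times> B| <o r"
proof -
  have "A \<times> B = (\<Union>a \<in> A. Pair a ` B)" by auto
  then show ?thesis using small_UN[OF assms(1)] small_image[OF assms(2)] by metis
qed

definition image_factorisation :: "'b \<Rightarrow> 'b \<Rightarrow> 'b \<Rightarrow> bool" where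
  "image_factorisation f e m \<longleftrightarrow> is_regular_epi C e \<and> is_mono C m \<and> e \<in> Ar C \<and> m \<in> Ar C \<and>
    Dom C e = Dom C f \<and> Cod C m = Cod C f \<and> Cod C e = Dom C m \<and> f = m \<cdot> e"

lemma image_factorisationD:
  assumes "image_factorisation f e m"
  shows "is_regular_epi C e" "is_mono C m" "e \<in> Ar C" "m \<in> Ar C" "Dom C e = Dom C f"
    "Cod C m = Cod C f" "Cod C e = Dom C m" "f = m \<cdot> e"
  using assms unfolding image_factorisation_def by blast+

lemma image_factorisations_exist:
  obtains e m where "\<And>f. f \<in> Ar C \<Longrightarrow> image_factorisation f (e f) (m f)"
proof -
  have img: "\<forall>f \<in> Ar C. \<exists>e m. is_regular_epi C e \<and> is_mono C m \<and> Cod C e = Dom C m \<and> f = m \<cdot> e"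
    using geometric
    unfolding geometric_category_def coherent_category_def regular_category_def by (elim conjE)
  have "\<exists>e m. image_factorisation f e m" if f: "f \<in> Ar C" for f
  proof -
    obtain e m where em: "is_regular_epi C e" "is_mono C m" "Cod C e = Dom C m" "f = m \<cdot> e"
      using bspec[OF img f] by (elim exE conjE)
    moreover have "e \<in> Ar C" "m \<in> Ar C"
      using em by (auto simp: is_regular_epi_def is_coequalizer_def is_mono_def)
    ultimately show ?thesis unfolding image_factorisation_def by (intro exI[of _ e] exI[of _ m]) simp
  qed
  then show thesis using that by metis
qed

lemma regular_epi_pullback:
  assumes "is_regular_epi C e" "is_pullback C f e p q"
  shows "is_regular_epi C p"
proof -
  have "\<forall>f e p q. is_regular_epi C e \<and> is_pullback C f e p q \<longrightarrow> is_regular_epi C p"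
    using geometric
    unfolding geometric_category_def coherent_category_def regular_category_def by (elim conjE)
  then show ?thesis using assms by iprover
qed

text \<open>The jointly extremal epimorphic families. That a monomorphism \<open>m\<close> is all of \<open>T\<close> is expressed by
  the identity factoring through it, since a monomorphism with a section is invertible.\<close>

definition covers :: "'a \<Rightarrow> 'b set \<Rightarrow> bool" where
  "covers T S \<longleftrightarrow> S \<subseteq> Ar C \<and> (\<forall>u \<in> S. Cod C u = T) \<and>
    (\<forall>m \<in> monos_into C T. (\<forall>u \<in> S. sub_le C u m) \<longrightarrow> sub_le C (ident C T) m)"

text \<open>The covers with fewer than \<open>r\<close> members generate a Grothendieck topology, and this is truth on a
  cover. For \<open>P u\<close> asserting that there is some \<open>x\<close> related to the restriction along \<open>u\<close>, it is the
  Kripke-Joyal interpretation of the existential statement.\<close>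

definition locally :: "'a \<Rightarrow> ('b \<Rightarrow> bool) \<Rightarrow> bool" where
  "locally T P \<longleftrightarrow> T \<in> Ob C \<and> (\<exists>S. |S| <o r \<and> covers T S \<and> (\<forall>u \<in> S. P u))"

lemma sub_le_pullback:
  assumes pb: "is_pullback C f m p q" and u: "u \<in> Ar C" "Cod C u = Dom C f"
  shows "sub_le C (f \<cdot> u) m \<longleftrightarrow> sub_le C u p"
proof
  note [simp] = pullback_simps(1-8)[OF pb]
  assume "sub_le C (f \<cdot> u) m"
  then obtain h where h: "f \<cdot> u = m \<cdot> h" "h \<in> Ar C" "Dom C h = Dom C (f \<cdot> u)" "Cod C h = Dom C m"
    by (rule sub_leE)
  have h3: "Dom C h = Dom C u" using h(3) u by simp
  obtain k where "k \<in> Ar C" "Dom C k = Dom C u" "Cod C k = Dom C p" "p \<cdot> k = u"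
    by (rule pullback_lift[OF pb u(1) h(2) h3 _ h(4) h(1)]) (use u in auto)
  then show "sub_le C u p" by (intro sub_leI[of _ _ k]) auto
next
  note [simp] = pullback_simps(1-8)[OF pb]
  assume "sub_le C u p"
  then obtain k where k: "u = p \<cdot> k" "k \<in> Ar C" "Dom C k = Dom C u" "Cod C k = Dom C p"
    by (rule sub_leE)
  have "f \<cdot> (p \<cdot> k) = m \<cdot> (q \<cdot> k)"
    by (rule cmp_extend[OF pullback_simps(9)[OF pb]]) (use k(2-4) in auto)
  then have "f \<cdot> u = m \<cdot> (q \<cdot> k)" using k(1) by metis
  then show "sub_le C (f \<cdot> u) m" by (rule sub_leI) (use k(2-4) u in auto)
qed

text \<open>Pulling \<open>m\<close> back along \<open>f\<close> turns the members of the cover into arrows that factor through a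
  subobject of \<open>Dom C f\<close>, which must then be everything.\<close>

lemma covers_factor:
  assumes S: "covers (Dom C f) S" and f: "f \<in> Ar C" and m: "is_mono C m" "Cod C m = Cod C f"
    and le: "\<And>u. u \<in> S \<Longrightarrow> sub_le C (f \<cdot> u) m"
  shows "sub_le C f m"
proof -
  have "m \<in> Ar C" using m by (simp add: is_mono_def)
  then obtain p q where pb: "is_pullback C f m p q" using pullback_exists f m by metis
  have "p \<in> monos_into C (Dom C f)"
    using pullback_of_mono[OF pb m(1)] pullback_simps[OF pb] by (simp add: monos_into_def)
  moreover have "sub_le C u p" if "u \<in> S" for u
    using le[OF that] S that sub_le_pullback[OF pb, of u] by (auto simp: covers_def)
  ultimately have "sub_le C (ident C (Dom C f)) p" using S by (auto simp: covers_def)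
  then show ?thesis using sub_le_pullback[OF pb, of "ident C (Dom C f)"] f by simp
qed

lemma locally_factor:
  assumes "locally (Dom C f) (\<lambda>u. sub_le C (f \<cdot> u) m)"
    and "f \<in> Ar C" "is_mono C m" "Cod C m = Cod C f"
  shows "sub_le C f m"
  using assms covers_factor unfolding locally_def by metis

lemma regular_epi_factor:
  assumes e: "is_regular_epi C e" and f: "f \<in> Ar C" "Dom C f = Cod C e"
    and m: "is_mono C m" "Cod C m = Cod C f" and le: "sub_le C (f \<cdot> e) m"
  shows "sub_le C f m"
proof -
  have "e \<in> Ar C" using e by (auto simp: is_regular_epi_def is_coequalizer_def)
  then have "covers (Cod C e) {e}"
    using regular_epi_extremal[OF e] by (auto simp: covers_def monos_into_def)
  then show ?thesis using covers_factor[of f "{e}" m] f m le by simp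
qed

lemma locally_mono:
  assumes "locally T P" and "\<And>u. \<lbrakk>u \<in> Ar C; Cod C u = T; P u\<rbrakk> \<Longrightarrow> Q u"
  shows "locally T Q"
proof -
  obtain S where "|S| <o r" "covers T S" "\<forall>u \<in> S. P u" "T \<in> Ob C"
    using assms(1) by (auto simp: locally_def)
  then show ?thesis unfolding locally_def using assms(2) by (auto simp: covers_def intro!: exI[of _ S])
qed

lemma locally_here:
  assumes T: "T \<in> Ob C" and P: "P (ident C T)"
  shows "locally T P"
  unfolding locally_def
proof (intro conjI exI)
  show "| {ident C T} | <o r" by (rule small_finite) simp
  show "covers T {ident C T}" using T by (auto simp: covers_def)
qed (use assms in auto)

text \<open>Transitivity of covers; this is where regularity of the cardinal enters.\<close>

lemma locally_bind:
  assumes P: "locally T P"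
    and Q: "\<And>u. \<lbrakk>u \<in> Ar C; Cod C u = T; P u\<rbrakk> \<Longrightarrow> locally (Dom C u) (\<lambda>v. Q (u \<cdot> v))"
  shows "locally T Q"
proof -
  obtain S where S: "|S| <o r" "covers T S" "\<forall>u \<in> S. P u" "T \<in> Ob C"
    using P by (auto simp: locally_def)
  have Su: "u \<in> Ar C" "Cod C u = T" if "u \<in> S" for u
    using S(2) that by (auto simp: covers_def)
  have "\<exists>R. |R| <o r \<and> covers (Dom C u) R \<and> (\<forall>v \<in> R. Q (u \<cdot> v))" if "u \<in> S" for u
    using Q[OF Su[OF that]] S(3) that unfolding locally_def by blast
  then obtain R where R: "\<And>u. u \<in> S \<Longrightarrow> |R u| <o r" "\<And>u. u \<in> S \<Longrightarrow> covers (Dom C u) (R u)"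
      "\<And>u v. \<lbrakk>u \<in> S; v \<in> R u\<rbrakk> \<Longrightarrow> Q (u \<cdot> v)"
    by metis
  have Rv: "v \<in> Ar C" "Cod C v = Dom C u" if "u \<in> S" "v \<in> R u" for u v
    using R(2) that by (auto simp: covers_def)
  let ?W = "\<Union>u \<in> S. (\<lambda>v. u \<cdot> v) ` R u"
  have "covers T ?W"
    unfolding covers_def
  proof (intro conjI ballI impI)
    show "?W \<subseteq> Ar C" using Su Rv by auto
    show "Cod C w = T" if "w \<in> ?W" for w using that Su Rv by auto
    fix m assume m: "m \<in> monos_into C T" and le: "\<forall>w \<in> ?W. sub_le C w m"
    have "sub_le C u m" if "u \<in> S" for u
      by (rule covers_factor[OF R(2)]) (use m le that Su in \<open>auto simp: monos_into_def\<close>)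
    then show "sub_le C (ident C T) m" using S(2) m by (auto simp: covers_def)
  qed
  moreover have "|?W| <o r" using S(1) R(1) by (intro small_UN small_image)
  ultimately show ?thesis unfolding locally_def using R(3) S(4) by (intro conjI exI[of _ ?W]) auto
qed

text \<open>A family covers \<open>T\<close> exactly when the union of the images of its members is all of \<open>T\<close>, and both
  images and unions are pullback-stable.\<close>

lemma covers_pullback:
  assumes S: "covers T S" "|S| <o r" and f: "f \<in> Ar C" "Cod C f = T"
    and pb: "\<And>s. s \<in> S \<Longrightarrow> is_pullback C f s (p s) (q s)"
  shows "covers (Dom C f) (p ` S)"
proof -
  have T: "T \<in> Ob C" using f by auto
  have Sa: "s \<in> Ar C" "Cod C s = T" if "s \<in> S" for s
    using S that by (auto simp: covers_def)
  obtain e m where fac: "\<And>f. f \<in> Ar C \<Longrightarrow> image_factorisation f (e f) (m f)"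
    using image_factorisations_exist by blast
  note em = image_factorisationD[OF fac[OF Sa(1)]]
  have "m ` S \<subseteq> monos_into C T" using em(2,6) Sa(2) by (auto simp: monos_into_def)
  moreover have "|m ` S| <o r" by (rule small_image[OF S(2)])
  ultimately have "has_stable_union C T (m ` S)"
    using geometric T unfolding geometric_category_def by blast
  then obtain u where u: "is_union C T (m ` S) u"
    and stable: "\<And>u'. is_inverse_image C f u u' \<Longrightarrow>
      is_union C (Dom C f) {m'. \<exists>m \<in> m ` S. is_inverse_image C f m m'} u'"
    using f unfolding has_stable_union_def by blast
  have um: "is_mono C u" "Cod C u = T" "u \<in> Ar C"
    using u by (auto simp: is_union_def monos_into_def is_mono_def)
  have "sub_le C s u" if "s \<in> S" for s
  proof (rule sub_le_trans[of _ "m s"])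
    show "sub_le C s (m s)"
      by (rule sub_leI[OF em(8) em(3) em(5) em(7)]) (rule that)+
    show "sub_le C (m s) u" using u that by (auto simp: is_union_def)
  qed (rule um)
  then have idu: "sub_le C (ident C T) u"
    using S(1) um by (auto simp: covers_def monos_into_def)
  obtain u' w where pbu: "is_pullback C f u u' w"
    using pullback_exists[of f u] f um by auto
  then have u': "is_union C (Dom C f) {m'. \<exists>m \<in> m ` S. is_inverse_image C f m m'} u'"
    by (intro stable) (auto simp: is_inverse_image_def)
  have "sub_le C f u" using sub_le_cmp[OF idu, of f] f um T by simp
  then have idu': "sub_le C (ident C (Dom C f)) u'"
    using sub_le_pullback[OF pbu, of "ident C (Dom C f)"] f by simp
  show ?thesis
    unfolding covers_def
  proof (intro conjI ballI impI)
    show "p ` S \<subseteq> Ar C" using pullback_simps[OF pb] by auto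
    show "Cod C x = Dom C f" if "x \<in> p ` S" for x using that pullback_simps[OF pb] by auto
    fix v assume v: "v \<in> monos_into C (Dom C f)" and le: "\<forall>x \<in> p ` S. sub_le C x v"
    have vm: "is_mono C v" "Cod C v = Dom C f" "v \<in> Ar C"
      using v by (auto simp: monos_into_def is_mono_def)
    have "sub_le C m' v" if s: "s \<in> S" and inv: "is_inverse_image C f (m s) m'" for s m'
    proof -
      obtain n where pbm: "is_pullback C f (m s) m' n" using inv by (auto simp: is_inverse_image_def)
      note [simp] = pullback_simps(1-8)[OF pbm]
      obtain e' n' where pbe: "is_pullback C n (e s) e' n'"
        using pullback_exists[of n "e s"] em(3,7)[OF s] by auto
      note [simp] = pullback_simps(1-8)[OF pbe]
      \<comment> \<open>The pulled back image \<open>m'\<close> is reached by a regular epimorphism \<open>e'\<close> whose composite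
        with \<open>m'\<close> factors through the pullback of \<open>s\<close>, hence through \<open>v\<close>.\<close>
      have "f \<cdot> (m' \<cdot> e') = m s \<cdot> (n \<cdot> e')"
        by (rule cmp_extend[OF pullback_simps(9)[OF pbm]]) auto
      also have "\<dots> = m s \<cdot> (e s \<cdot> n')" by (simp add: pullback_simps(9)[OF pbe])
      also have "\<dots> = s \<cdot> n'" using em[OF s] by (metis cmp_assoc' pullback_simps(2,4,8)[OF pbe])
      finally have eq: "f \<cdot> (m' \<cdot> e') = s \<cdot> n'" .
      have "sub_le C (f \<cdot> (m' \<cdot> e')) s"
        by (rule sub_leI[OF eq]) (use em(5)[OF s] in auto)
      then have "sub_le C (m' \<cdot> e') (p s)"
        by (subst sub_le_pullback[OF pb[OF s], symmetric]) auto
      then have "sub_le C (m' \<cdot> e') v"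
        by (rule sub_le_trans) (use le s vm in auto)
      moreover have "is_regular_epi C e'" by (rule regular_epi_pullback[OF em(1)[OF s] pbe])
      ultimately show "sub_le C m' v"
        using vm by - (rule regular_epi_factor[of e'], auto)
    qed
    then have "sub_le C u' v" using u' v by (auto simp: is_union_def)
    then show "sub_le C (ident C (Dom C f)) v" using idu' vm by (auto intro: sub_le_trans)
  qed
qed

lemma locally_pullback:
  assumes P: "locally T P" and f: "f \<in> Ar C" "Cod C f = T"
  shows "locally (Dom C f) (\<lambda>v. \<exists>u \<in> Ar C. \<exists>h \<in> Ar C. P u \<and> Cod C u = T \<and>
    Dom C h = Dom C v \<and> Cod C h = Dom C u \<and> f \<cdot> v = u \<cdot> h)"
proof -
  obtain S where S: "|S| <o r" "covers T S" "\<forall>u \<in> S. P u"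
    using P by (auto simp: locally_def)
  have Su: "u \<in> Ar C" "Cod C u = T" if "u \<in> S" for u
    using S(2) that by (auto simp: covers_def)
  have "\<exists>p q. is_pullback C f u p q" if "u \<in> S" for u
    using pullback_exists[of f u] Su[OF that] f by metis
  then obtain p q where pb: "\<And>u. u \<in> S \<Longrightarrow> is_pullback C f u (p u) (q u)" by metis
  have "covers (Dom C f) (p ` S)" using S f pb by (intro covers_pullback)
  moreover have "|p ` S| <o r" using S(1) by (rule small_image)
  moreover have "\<exists>u \<in> Ar C. \<exists>h \<in> Ar C. P u \<and> Cod C u = T \<and>
    Dom C h = Dom C v \<and> Cod C h = Dom C u \<and> f \<cdot> v = u \<cdot> h" if v: "v \<in> p ` S" for v
  proof -
    obtain u where u: "u \<in> S" "v = p u" using v by auto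
    then show ?thesis
      using S(3) Su[OF u(1)] pullback_simps[OF pb[OF u(1)]]
      by (intro bexI[of _ u] bexI[of _ "q u"]) auto
  qed
  ultimately show ?thesis unfolding locally_def using f by auto
qed

text \<open>An equation between \<open>f\<close> and \<open>g\<close> is a factorisation through their equaliser, so it descends from
  a cover like any factorisation through a monomorphism.\<close>

lemma locally_separated:
  assumes loc: "locally (Dom C f) (\<lambda>u. f \<cdot> u = g \<cdot> u)"
    and fg: "f \<in> Ar C" "g \<in> Ar C" "Dom C g = Dom C f" "Cod C g = Cod C f"
  shows "f = g"
proof -
  obtain m where m: "is_mono C m" "Cod C m = Dom C f"
    and eq: "\<And>u. \<lbrakk>u \<in> Ar C; Cod C u = Dom C f\<rbrakk> \<Longrightarrow> f \<cdot> u = g \<cdot> u \<longleftrightarrow> sub_le C u m"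
    using equaliser_exists[of f g] fg by metis
  have "locally (Dom C f) (\<lambda>u. sub_le C (ident C (Dom C f) \<cdot> u) m)"
    using loc by (rule locally_mono) (use eq in auto)
  then have "sub_le C (ident C (Dom C f)) m"
    using fg m by (intro locally_factor) auto
  then show ?thesis using eq[of "ident C (Dom C f)"] fg by simp
qed

text \<open>The joint image of a small family. By construction the family covers it, so its elements are,
  locally, elements of the domains of the family.\<close>

lemma family_image:
  assumes X: "X \<in> Ob C" and A: "A \<subseteq> Ar C" "\<And>a. a \<in> A \<Longrightarrow> Cod C a = X" "|A| <o r"
  obtains m where "is_mono C m" "Cod C m = X" "\<And>a. a \<in> A \<Longrightarrow> sub_le C a m"
    "locally (Dom C m) (\<lambda>w. m \<cdot> w \<in> A)"
proof -
  obtain e m where fac: "\<And>f. f \<in> Ar C \<Longrightarrow> image_factorisation f (e f) (m f)"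
    using image_factorisations_exist by blast
  have Aa: "a \<in> Ar C" "Cod C a = X" if "a \<in> A" for a using A that by auto
  note em = image_factorisationD[OF fac[OF Aa(1)]]
  have "m ` A \<subseteq> monos_into C X" using em(2,6) Aa(2) by (auto simp: monos_into_def)
  moreover have "|m ` A| <o r" by (rule small_image[OF A(3)])
  ultimately obtain u where u: "is_union C X (m ` A) u"
    using geometric X unfolding geometric_category_def has_stable_union_def by blast
  have um: "is_mono C u" "Cod C u = X" "u \<in> Ar C"
    using u by (auto simp: is_union_def monos_into_def is_mono_def)
  have le: "sub_le C a u" if "a \<in> A" for a
  proof (rule sub_le_trans[of _ "m a"])
    show "sub_le C a (m a)"
      by (rule sub_leI[OF em(8) em(3) em(5) em(7)]) (rule that)+
    show "sub_le C (m a) u" using u that by (auto simp: is_union_def)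
  qed (rule um)
  then have "\<exists>h. a = u \<cdot> h \<and> h \<in> Ar C \<and> Cod C h = Dom C u" if "a \<in> A" for a
    using that by (metis sub_leE)
  then obtain h where h: "\<And>a. a \<in> A \<Longrightarrow> a = u \<cdot> h a"
      "\<And>a. a \<in> A \<Longrightarrow> h a \<in> Ar C" "\<And>a. a \<in> A \<Longrightarrow> Cod C (h a) = Dom C u"
    by metis
  have "covers (Dom C u) (h ` A)"
    unfolding covers_def
  proof (intro conjI ballI impI)
    show "h ` A \<subseteq> Ar C" "\<And>x. x \<in> h ` A \<Longrightarrow> Cod C x = Dom C u" using h by auto
    fix v assume v: "v \<in> monos_into C (Dom C u)" and lev: "\<forall>x \<in> h ` A. sub_le C x v"
    have vm: "is_mono C v" "Cod C v = Dom C u" "v \<in> Ar C"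
      using v by (auto simp: monos_into_def is_mono_def)
    have uv: "is_mono C (u \<cdot> v)" using um vm by (intro mono_cmp) auto
    have "sub_le C (m a) (u \<cdot> v)" if a: "a \<in> A" for a
    proof (rule regular_epi_factor[OF em(1)[OF a] _ _ uv])
      obtain t where t: "h a = v \<cdot> t" "t \<in> Ar C" "Dom C t = Dom C (h a)" "Cod C t = Dom C v"
        using lev a by (meson imageI sub_leE)
      have "m a \<cdot> e a = u \<cdot> (v \<cdot> t)" using em(8)[OF a] h(1)[OF a] t(1) by metis
      also have "\<dots> = (u \<cdot> v) \<cdot> t" using t(2,4) um vm by simp
      finally have "m a \<cdot> e a = (u \<cdot> v) \<cdot> t" .
      moreover have "Dom C a = Dom C (h a)"
        using h[OF a] um by (metis Dom_cmp)
      ultimately show "sub_le C (m a \<cdot> e a) (u \<cdot> v)"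
        using t(2-4) um vm em(3-7)[OF a] Aa(2)[OF a] by (intro sub_leI[of _ _ t]) auto
    qed (use em(2-7)[OF a] Aa(2)[OF a] um vm in auto)
    then have "sub_le C u (u \<cdot> v)"
      using u uv um vm by (auto simp: is_union_def monos_into_def)
    then obtain k where k: "u = (u \<cdot> v) \<cdot> k" "k \<in> Ar C" "Dom C k = Dom C u" "Cod C k = Dom C (u \<cdot> v)"
      by (rule sub_leE)
    have "u \<cdot> ident C (Dom C u) = u \<cdot> (v \<cdot> k)" using k(2-4) um vm
      by (metis Dom_cmp cmp_assoc' cmp_ident(1) k(1))
    then have "ident C (Dom C u) = v \<cdot> k"
      by (rule mono_cancel[OF um(1)]) (use k(2-4) um vm in auto)
    then show "sub_le C (ident C (Dom C u)) v"
      using k(2-4) um vm by (intro sub_leI[of _ _ k]) auto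
  qed
  moreover have "|h ` A| <o r" by (rule small_image[OF A(3)])
  moreover have "u \<cdot> w \<in> A" if "w \<in> h ` A" for w using that h(1) by auto
  ultimately have "locally (Dom C u) (\<lambda>w. u \<cdot> w \<in> A)"
    unfolding locally_def using um by auto
  with um le show thesis by (intro that)
qed

lemma locally_member:
  assumes T: "T \<in> Ob C" and A: "A \<subseteq> Ar C" "\<And>a. a \<in> A \<Longrightarrow> Cod C a = T" "|A| <o r"
    and split: "\<And>m. \<lbrakk>is_mono C m; Cod C m = T; \<forall>a \<in> A. sub_le C a m\<rbrakk> \<Longrightarrow> sub_le C (ident C T) m"
  shows "locally T (\<lambda>u. u \<in> A)"
  unfolding locally_def covers_def using assms
  by (intro conjI exI[of _ A]) (auto simp: monos_into_def)

text \<open>An initial object is covered by the empty family: a subobject of it has a section because maps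
  out of the object are unique.\<close>

lemma locally_initial:
  assumes "is_initial C T"
  shows "locally T P"
proof -
  have T: "T \<in> Ob C" and uniq: "\<And>y. y \<in> Ob C \<Longrightarrow> \<exists>!h. h \<in> hom C T y"
    using assms by (auto simp: is_initial_def)
  have "locally T (\<lambda>u. u \<in> {})"
  proof (rule locally_member)
    show "| {} | <o r" by (rule small_finite) simp
    fix m assume m: "is_mono C m" "Cod C m = T"
    then have ma: "m \<in> Ar C" by (simp add: is_mono_def)
    then obtain h where "h \<in> hom C T (Dom C m)" using uniq[of "Dom C m"] by auto
    then have h: "h \<in> Ar C" "Dom C h = T" "Cod C h = Dom C m" by (auto simp: hom_def)
    have "m \<cdot> h \<in> hom C T T" "ident C T \<in> hom C T T" using m ma h T by (auto simp: hom_def)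
    then have "ident C T = m \<cdot> h" using uniq[OF T] by auto
    then show "sub_le C (ident C T) m" by (rule sub_leI) (use h T in auto)
  qed (use T in auto)
  then show ?thesis by (rule locally_mono) simp
qed

end


section \<open>Filtered colimits in a pretopos\<close>

locale lambda_pretopos = lambda_geometric +
  assumes pretopos: "pretopos r C"
begin

text \<open>The axiom provides coproducts indexed by subsets of the type underlying \<open>r\<close>; any other small
  index set is transported along an injection into the field of \<open>r\<close>.\<close>

lemma small_coproduct:
  fixes I :: "'i set"
  assumes I: "|I| <o r" and A: "\<And>i. i \<in> I \<Longrightarrow> A i \<in> Ob C"
  obtains s inc where "is_coproduct C I A s inc" "disjoint_injections C I inc"
proof -
  have "|I| \<le>o |Field r|"
    using I infinite_card by (meson card_of_Field_ordIso ordIso_iff_ordLeq ordLeq_transitive ordLess_imp_ordLeq)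
  then have "\<exists>f. inj_on f I \<and> f ` I \<subseteq> Field r" by (rule iffD2[OF card_of_ordLeq])
  then obtain f where "inj_on f I \<and> f ` I \<subseteq> Field r" by (rule exE)
  then have f: "inj_on f I" by (rule conjunct1)
  define g where "g = inv_into I f"
  have gf: "g (f i) = i" if "i \<in> I" for i using f that by (simp add: g_def)
  have "|f ` I| <o r" using I by (rule small_image)
  moreover have "\<forall>i \<in> f ` I. A (g i) \<in> Ob C" using A gf by auto
  ultimately obtain s inc where cop: "is_coproduct C (f ` I) (\<lambda>i. A (g i)) s inc"
    and dis: "disjoint_injections C (f ` I) inc"
    using pretopos unfolding pretopos_def by meson
  have "is_coproduct C I A s (\<lambda>i. inc (f i))"
    unfolding is_coproduct_def
  proof (intro conjI ballI allI impI)
    show "s \<in> Ob C" "\<And>i. i \<in> I \<Longrightarrow> inc (f i) \<in> hom C (A i) s"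
      using cop gf by (auto simp: is_coproduct_def)
    fix y k assume y: "y \<in> Ob C" and k: "\<forall>i \<in> I. k i \<in> hom C (A i) y"
    have "\<forall>i \<in> f ` I. k (g i) \<in> hom C (A (g i)) y" using k gf by auto
    moreover have "\<forall>l. (\<forall>i \<in> f ` I. l i \<in> hom C (A (g i)) y) \<longrightarrow>
        (\<exists>!h. h \<in> hom C s y \<and> (\<forall>i \<in> f ` I. h \<cdot> inc i = l i))"
      using cop y by (simp add: is_coproduct_def)
    ultimately have "\<exists>!h. h \<in> hom C s y \<and> (\<forall>i \<in> f ` I. h \<cdot> inc i = k (g i))"
      by (rule mp[OF spec[of _ "\<lambda>i. k (g i)"], rotated])
    moreover have "(\<forall>i \<in> f ` I. h \<cdot> inc i = k (g i)) \<longleftrightarrow> (\<forall>i \<in> I. h \<cdot> inc (f i) = k i)" for h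
      using gf by auto
    ultimately show "\<exists>!h. h \<in> hom C s y \<and> (\<forall>i \<in> I. h \<cdot> inc (f i) = k i)" by simp
  qed
  moreover have "disjoint_injections C I (\<lambda>i. inc (f i))"
    using dis f unfolding disjoint_injections_def inj_on_def by blast
  ultimately show thesis by (rule that)
qed

end

locale small_filtered_diagram = lambda_pretopos + J: category J for J :: "('i, 'j) cat" +
  fixes G :: "('i, 'j, 'a, 'b) func"
  assumes filtered: "filtered_category J" and small_J: "|Ar J| <o r"
    and functor_G: "is_functor J C G"
begin

lemma small_Ob_J: "|Ob J| <o r"
proof -
  have "Ob J \<subseteq> Dom J ` Ar J" using J.ident_simps by (metis image_eqI subsetI)
  then show ?thesis
    using small_image[OF small_J] card_of_mono1 ordLeq_ordLess_trans by blast
qed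

lemma G_simps [simp]:
  "i \<in> Ob J \<Longrightarrow> ob G i \<in> Ob C"
  "f \<in> Ar J \<Longrightarrow> ar G f \<in> Ar C"
  "f \<in> Ar J \<Longrightarrow> Dom C (ar G f) = ob G (Dom J f)"
  "f \<in> Ar J \<Longrightarrow> Cod C (ar G f) = ob G (Cod J f)"
  "i \<in> Ob J \<Longrightarrow> ar G (ident J i) = ident C (ob G i)"
  "\<lbrakk>f \<in> Ar J; g \<in> Ar J; Dom J g = Cod J f\<rbrakk> \<Longrightarrow> ar G (g \<cdot>\<^bsub>J\<^esub> f) = ar G g \<cdot> ar G f"
  using functor_G by (auto simp: is_functor_def hom_def)

lemma bound:
  assumes "x \<in> Ob J" "y \<in> Ob J"
  obtains f g where "f \<in> Ar J" "g \<in> Ar J" "Dom J f = x" "Dom J g = y" "Cod J g = Cod J f"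
proof -
  obtain z where "hom J x z \<noteq> {}" "hom J y z \<noteq> {}"
    using filtered assms unfolding filtered_category_def by blast
  then show thesis using that by (auto simp: hom_def)
qed

lemma coequalise:
  assumes "f \<in> Ar J" "g \<in> Ar J" "Dom J f = Dom J g" "Cod J f = Cod J g"
  obtains h where "h \<in> Ar J" "Dom J h = Cod J f" "h \<cdot>\<^bsub>J\<^esub> f = h \<cdot>\<^bsub>J\<^esub> g"
  using filtered assms unfolding filtered_category_def by blast

text \<open>Bound the two targets, then coequalise the two composites.\<close>

lemma amalgamate:
  assumes fg: "f \<in> Ar J" "g \<in> Ar J" "Dom J f = Dom J g"
  obtains f' g' where "f' \<in> Ar J" "g' \<in> Ar J" "Dom J f' = Cod J f" "Dom J g' = Cod J g"
    "Cod J g' = Cod J f'" "f' \<cdot>\<^bsub>J\<^esub> f = g' \<cdot>\<^bsub>J\<^esub> g"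
proof -
  obtain a b where ab: "a \<in> Ar J" "b \<in> Ar J" "Dom J a = Cod J f" "Dom J b = Cod J g" "Cod J b = Cod J a"
    using bound[of "Cod J f" "Cod J g"] fg by auto
  obtain h where h: "h \<in> Ar J" "Dom J h = Cod J (a \<cdot>\<^bsub>J\<^esub> f)"
      "h \<cdot>\<^bsub>J\<^esub> (a \<cdot>\<^bsub>J\<^esub> f) = h \<cdot>\<^bsub>J\<^esub> (b \<cdot>\<^bsub>J\<^esub> g)"
    using coequalise[of "a \<cdot>\<^bsub>J\<^esub> f" "b \<cdot>\<^bsub>J\<^esub> g"] ab fg by auto
  show thesis
    by (rule that[of "h \<cdot>\<^bsub>J\<^esub> a" "h \<cdot>\<^bsub>J\<^esub> b"]) (use ab fg h in auto)
qed

end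


locale diagram_coproduct = small_filtered_diagram +
  fixes s :: 'a and inc :: "'d \<Rightarrow> 'b"
  assumes coproduct: "is_coproduct C (Ob J) (ob G) s inc"
    and disjoint: "disjoint_injections C (Ob J) inc"
begin

lemma s_Ob [simp]: "s \<in> Ob C"
  using coproduct by (simp add: is_coproduct_def)

lemma inc_simps [simp]:
  "i \<in> Ob J \<Longrightarrow> inc i \<in> Ar C" "i \<in> Ob J \<Longrightarrow> Dom C (inc i) = ob G i" "i \<in> Ob J \<Longrightarrow> Cod C (inc i) = s"
  using coproduct by (auto simp: is_coproduct_def hom_def)

lemma inc_mono: "i \<in> Ob J \<Longrightarrow> is_mono C (inc i)"
  using disjoint by (simp add: disjoint_injections_def)

lemma coproduct_universal:
  assumes "y \<in> Ob C" "\<And>i. i \<in> Ob J \<Longrightarrow> g i \<in> hom C (ob G i) y"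
  shows "\<exists>!h. h \<in> hom C s y \<and> (\<forall>i \<in> Ob J. h \<cdot> inc i = g i)"
  using coproduct assms unfolding is_coproduct_def by blast

lemma locally_in_summand: "locally s (\<lambda>u. u \<in> inc ` Ob J)"
proof (rule locally_member)
  show "|inc ` Ob J| <o r" by (rule small_image[OF small_Ob_J])
  fix m assume m: "is_mono C m" "Cod C m = s" "\<forall>a \<in> inc ` Ob J. sub_le C a m"
  have ma: "m \<in> Ar C" using m by (simp add: is_mono_def)
  have "\<forall>i \<in> Ob J. \<exists>t. t \<in> hom C (ob G i) (Dom C m) \<and> inc i = m \<cdot> t"
    using m(3) by (auto simp: sub_le_def)
  then obtain t where t: "\<And>i. i \<in> Ob J \<Longrightarrow> t i \<in> hom C (ob G i) (Dom C m)"
      "\<And>i. i \<in> Ob J \<Longrightarrow> m \<cdot> t i = inc i"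
    by metis
  have "\<exists>!h. h \<in> hom C s (Dom C m) \<and> (\<forall>i \<in> Ob J. h \<cdot> inc i = t i)"
    by (rule coproduct_universal) (use t(1) ma in auto)
  then obtain h where "h \<in> hom C s (Dom C m)" "\<forall>i \<in> Ob J. h \<cdot> inc i = t i" by (elim ex1E conjE)
  then have h: "h \<in> Ar C" "Dom C h = s" "Cod C h = Dom C m" "\<And>i. i \<in> Ob J \<Longrightarrow> h \<cdot> inc i = t i"
    by (auto simp: hom_def)
  have "\<exists>!k. k \<in> hom C s s \<and> (\<forall>i \<in> Ob J. k \<cdot> inc i = inc i)"
    by (rule coproduct_universal) (auto simp: hom_def)
  moreover have "m \<cdot> h \<in> hom C s s \<and> (\<forall>i \<in> Ob J. (m \<cdot> h) \<cdot> inc i = inc i)"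
    using h t(2) ma m(2) by (auto simp: hom_def)
  moreover have "ident C s \<in> hom C s s \<and> (\<forall>i \<in> Ob J. ident C s \<cdot> inc i = inc i)"
    by (auto simp: hom_def)
  ultimately have "ident C s = m \<cdot> h" by (metis (no_types, lifting))
  then show "sub_le C (ident C s) m" by (rule sub_leI) (use h in auto)
qed auto

text \<open>Over a stage where two different summands meet everything holds locally, since that stage
  lies over an initial object, which is covered by the empty family.\<close>

lemma locally_disjoint_summands:
  assumes ij: "i \<in> Ob J" "j \<in> Ob J" "i \<noteq> j"
    and x: "x \<in> Ar C" "Cod C x = ob G i" and y: "y \<in> Ar C" "Cod C y = ob G j" "Dom C y = Dom C x"
    and eq: "inc i \<cdot> x = inc j \<cdot> y"
  shows "locally (Dom C x) P"
proof -
  obtain p q where pb: "is_pullback C (inc i) (inc j) p q"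
    using pullback_exists[of "inc i" "inc j"] ij by auto
  then have "is_initial C (Dom C p)" using disjoint ij unfolding disjoint_injections_def by blast
  then have ini: "locally (Dom C p) (\<lambda>_. False)" by (rule locally_initial)
  obtain h where "h \<in> Ar C" "Dom C h = Dom C x" "Cod C h = Dom C p"
    by (rule pullback_lift[OF pb x(1) y(1,3)]) (use ij x y eq in auto)
  then show ?thesis using locally_pullback[OF ini, of h] by (auto elim: locally_mono)
qed

text \<open>Two generalised elements of the coproduct are linked when they lie in summands and are
  identified by arrows of the diagram; the colimit is the quotient of the coproduct by the local
  closure of this relation.\<close>

definition linked :: "'b \<Rightarrow> 'b \<Rightarrow> bool" where
  "linked x y \<longleftrightarrow> (\<exists>f \<in> Ar J. \<exists>g \<in> Ar J. \<exists>p \<in> Ar C. \<exists>q \<in> Ar C.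
    Cod J g = Cod J f \<and> Dom C q = Dom C p \<and> Cod C p = ob G (Dom J f) \<and> Cod C q = ob G (Dom J g) \<and>
    x = inc (Dom J f) \<cdot> p \<and> y = inc (Dom J g) \<cdot> q \<and> ar G f \<cdot> p = ar G g \<cdot> q)"

lemma linkedI:
  assumes "f \<in> Ar J" "g \<in> Ar J" "p \<in> Ar C" "q \<in> Ar C" "Cod J g = Cod J f" "Dom C q = Dom C p"
    "Cod C p = ob G (Dom J f)" "Cod C q = ob G (Dom J g)"
    "x = inc (Dom J f) \<cdot> p" "y = inc (Dom J g) \<cdot> q" "ar G f \<cdot> p = ar G g \<cdot> q"
  shows "linked x y"
  using assms unfolding linked_def by blast

lemma linkedE:
  assumes "linked x y"
  obtains f g p q where "f \<in> Ar J" "g \<in> Ar J" "p \<in> Ar C" "q \<in> Ar C" "Cod J g = Cod J f"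
    "Dom C p = Dom C x" "Dom C q = Dom C x" "Cod C p = ob G (Dom J f)" "Cod C q = ob G (Dom J g)"
    "x = inc (Dom J f) \<cdot> p" "y = inc (Dom J g) \<cdot> q" "ar G f \<cdot> p = ar G g \<cdot> q"
proof -
  obtain f g p q where *: "f \<in> Ar J" "g \<in> Ar J" "p \<in> Ar C" "q \<in> Ar C" "Cod J g = Cod J f"
    "Dom C q = Dom C p" "Cod C p = ob G (Dom J f)" "Cod C q = ob G (Dom J g)"
    and x: "x = inc (Dom J f) \<cdot> p" and y: "y = inc (Dom J g) \<cdot> q" "ar G f \<cdot> p = ar G g \<cdot> q"
    using assms unfolding linked_def by blast
  have "Dom C p = Dom C x" unfolding x using * by simp
  then show thesis using that[OF *(1-5) _ _ *(7,8) x y] *(6) by simp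
qed

lemma linked_Ar:
  assumes "linked x y"
  shows "x \<in> Ar C" "y \<in> Ar C" "Dom C y = Dom C x" "Cod C x = s" "Cod C y = s"
proof -
  obtain f g p q where *: "f \<in> Ar J" "g \<in> Ar J" "p \<in> Ar C" "q \<in> Ar C"
    "Dom C p = Dom C x" "Dom C q = Dom C x" "Cod C p = ob G (Dom J f)" "Cod C q = ob G (Dom J g)"
    and x: "x = inc (Dom J f) \<cdot> p" and y: "y = inc (Dom J g) \<cdot> q"
    using assms by (rule linkedE) blast
  show "x \<in> Ar C" "Cod C x = s" unfolding x using *(1-4,7,8) by auto
  show "y \<in> Ar C" "Cod C y = s" unfolding y using *(1-4,7,8) by auto
  have "Dom C y = Dom C q" unfolding y using *(1-4,7,8) by simp
  then show "Dom C y = Dom C x" using * by simp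
qed

lemma linked_sym: "linked x y \<Longrightarrow> linked y x"
  unfolding linked_def by metis

lemma linked_restrict:
  assumes "linked x y" and v: "v \<in> Ar C" "Cod C v = Dom C x"
  shows "linked (x \<cdot> v) (y \<cdot> v)"
proof -
  obtain f g p q where *: "f \<in> Ar J" "g \<in> Ar J" "p \<in> Ar C" "q \<in> Ar C" "Cod J g = Cod J f"
    "Dom C p = Dom C x" "Dom C q = Dom C x" "Cod C p = ob G (Dom J f)" "Cod C q = ob G (Dom J g)"
    and x: "x = inc (Dom J f) \<cdot> p" and y: "y = inc (Dom J g) \<cdot> q" and eq: "ar G f \<cdot> p = ar G g \<cdot> q"
    using assms(1) by (rule linkedE) blast
  have pv: "Cod C v = Dom C p" "Cod C v = Dom C q" using * v by auto
  show ?thesis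
  proof (rule linkedI)
    show "x \<cdot> v = inc (Dom J f) \<cdot> (p \<cdot> v)" unfolding x using *(1-4,8,9) v(1) pv(1) by simp
    show "y \<cdot> v = inc (Dom J g) \<cdot> (q \<cdot> v)" unfolding y using *(1-4,8,9) v(1) pv(2) by simp
    show "ar G f \<cdot> (p \<cdot> v) = ar G g \<cdot> (q \<cdot> v)"
      by (rule cmp_extend[OF eq]) (use *(1-9) v pv in auto)
  qed (use *(1-9) v pv in auto)
qed

text \<open>For links \<open>x ~ y\<close> and \<open>y ~ z\<close> the two presentations of \<open>y\<close> agree locally by disjointness, and
  filteredness merges the two identifications into one.\<close>

lemma linked_trans:
  assumes "linked x y" "linked y z"
  shows "locally (Dom C x) (\<lambda>v. linked (x \<cdot> v) (z \<cdot> v))"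
proof -
  note A = linked_Ar[OF assms(1)] linked_Ar[OF assms(2)]
  obtain f g p q where *: "f \<in> Ar J" "g \<in> Ar J" "p \<in> Ar C" "q \<in> Ar C" "Cod J g = Cod J f"
    "Dom C p = Dom C x" "Dom C q = Dom C x" "Cod C p = ob G (Dom J f)" "Cod C q = ob G (Dom J g)"
    and x: "x = inc (Dom J f) \<cdot> p" and y: "y = inc (Dom J g) \<cdot> q" and eq: "ar G f \<cdot> p = ar G g \<cdot> q"
    using assms(1) by (rule linkedE) blast
  obtain f' g' p' q' where **: "f' \<in> Ar J" "g' \<in> Ar J" "p' \<in> Ar C" "q' \<in> Ar C" "Cod J g' = Cod J f'"
    "Dom C p' = Dom C y" "Dom C q' = Dom C y" "Cod C p' = ob G (Dom J f')" "Cod C q' = ob G (Dom J g')"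
    and y': "y = inc (Dom J f') \<cdot> p'" and z: "z = inc (Dom J g') \<cdot> q'" and eq': "ar G f' \<cdot> p' = ar G g' \<cdot> q'"
    using assms(2) by (rule linkedE) blast
  have yy: "inc (Dom J g) \<cdot> q = inc (Dom J f') \<cdot> p'" using y y' by simp
  have d: "Dom C p' = Dom C x" "Dom C q' = Dom C x" using **(6,7) A(3) by auto
  show ?thesis
  proof (cases "Dom J g = Dom J f'")
    case False
    show ?thesis
      using locally_disjoint_summands[OF _ _ False *(4,9) **(3,8) _ yy] * ** d by simp
  next
    case True
    have qp: "q = p'"
      by (rule mono_cancel[OF inc_mono[of "Dom J g"]]) (use yy True * **(1-5,8,9) d in auto)
    obtain k l where kl: "k \<in> Ar J" "l \<in> Ar J" "Dom J k = Cod J g" "Dom J l = Cod J f'"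
        "Cod J l = Cod J k" "k \<cdot>\<^bsub>J\<^esub> g = l \<cdot>\<^bsub>J\<^esub> f'"
      using amalgamate[OF *(2) **(1) True] by blast
    have "linked x z"
    proof (rule linkedI[of "k \<cdot>\<^bsub>J\<^esub> f" "l \<cdot>\<^bsub>J\<^esub> g'" p q'])
      have "ar G (k \<cdot>\<^bsub>J\<^esub> f) \<cdot> p = ar G k \<cdot> (ar G f \<cdot> p)" using *(1-5,8,9) kl(1-5) by simp
      also have "\<dots> = ar G (k \<cdot>\<^bsub>J\<^esub> g) \<cdot> q" using eq *(1-5,8,9) kl(1-5) by simp
      also have "\<dots> = ar G (l \<cdot>\<^bsub>J\<^esub> f') \<cdot> p'" by (simp only: kl(6) qp)
      also have "\<dots> = ar G l \<cdot> (ar G f' \<cdot> p')" using **(1-5,8,9) kl(1-5) by simp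
      also have "\<dots> = ar G (l \<cdot>\<^bsub>J\<^esub> g') \<cdot> q'" using eq' **(1-5,8,9) kl(1-5) by simp
      finally show "ar G (k \<cdot>\<^bsub>J\<^esub> f) \<cdot> p = ar G (l \<cdot>\<^bsub>J\<^esub> g') \<cdot> q'" .
      show "x = inc (Dom J (k \<cdot>\<^bsub>J\<^esub> f)) \<cdot> p" using x *(1-5,8,9) kl(1-5) by simp
      show "z = inc (Dom J (l \<cdot>\<^bsub>J\<^esub> g')) \<cdot> q'" using z **(1-5,8,9) kl(1-5) by simp
    qed (use *(1-6,8,9) **(1-5,8,9) d kl(1-5) in auto)
    then have "linked (x \<cdot> ident C (Dom C x)) (z \<cdot> ident C (Dom C x))"
      using A by simp
    then show ?thesis using A by (intro locally_here) auto
  qed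
qed

definition related :: "'b \<Rightarrow> 'b \<Rightarrow> bool" where
  "related a b \<longleftrightarrow> locally (Dom C a) (\<lambda>u. linked (a \<cdot> u) (b \<cdot> u))"

lemma related_restrict:
  assumes ab: "related a b" and a: "a \<in> Ar C" "b \<in> Ar C" "Dom C b = Dom C a"
    and f: "f \<in> Ar C" "Cod C f = Dom C a"
  shows "related (a \<cdot> f) (b \<cdot> f)"
proof -
  have "locally (Dom C f) (\<lambda>v. \<exists>u \<in> Ar C. \<exists>h \<in> Ar C. linked (a \<cdot> u) (b \<cdot> u) \<and> Cod C u = Dom C a \<and>
    Dom C h = Dom C v \<and> Cod C h = Dom C u \<and> f \<cdot> v = u \<cdot> h)"
    by (rule locally_pullback[OF ab[unfolded related_def] f])
  then have "locally (Dom C f) (\<lambda>v. linked ((a \<cdot> f) \<cdot> v) ((b \<cdot> f) \<cdot> v))"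
  proof (rule locally_mono)
    fix v assume v: "v \<in> Ar C" "Cod C v = Dom C f"
      and "\<exists>u \<in> Ar C. \<exists>h \<in> Ar C. linked (a \<cdot> u) (b \<cdot> u) \<and> Cod C u = Dom C a \<and>
        Dom C h = Dom C v \<and> Cod C h = Dom C u \<and> f \<cdot> v = u \<cdot> h"
    then obtain u h where uh: "u \<in> Ar C" "h \<in> Ar C" "linked (a \<cdot> u) (b \<cdot> u)" "Cod C u = Dom C a"
      "Cod C h = Dom C u" "f \<cdot> v = u \<cdot> h" by blast
    have "linked ((a \<cdot> u) \<cdot> h) ((b \<cdot> u) \<cdot> h)"
      by (rule linked_restrict[OF uh(3)]) (use uh a in auto)
    then show "linked ((a \<cdot> f) \<cdot> v) ((b \<cdot> f) \<cdot> v)" using uh a f v by simp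
  qed
  then show ?thesis unfolding related_def using a f by simp
qed

lemma related_refl:
  assumes a: "a \<in> Ar C" "Cod C a = s"
  shows "related a a"
  unfolding related_def
proof (rule locally_mono[OF locally_pullback[OF locally_in_summand a]])
  fix v assume v: "v \<in> Ar C" "Cod C v = Dom C a"
    and "\<exists>u \<in> Ar C. \<exists>h \<in> Ar C. u \<in> inc ` Ob J \<and> Cod C u = s \<and>
      Dom C h = Dom C v \<and> Cod C h = Dom C u \<and> a \<cdot> v = u \<cdot> h"
  then obtain i h where i: "i \<in> Ob J" "h \<in> Ar C" "Dom C h = Dom C v" "Cod C h = ob G i" "a \<cdot> v = inc i \<cdot> h"
    by auto
  show "linked (a \<cdot> v) (a \<cdot> v)"
    by (rule linkedI[of "ident J i" "ident J i" h h]) (use i in auto)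
qed

lemma related_sym:
  assumes "related a b" "Dom C b = Dom C a"
  shows "related b a"
  using assms unfolding related_def by (auto elim: locally_mono intro: linked_sym)

lemma related_trans:
  assumes ab: "related a b" and bc: "related b c"
    and A: "a \<in> Ar C" "b \<in> Ar C" "c \<in> Ar C" "Dom C b = Dom C a" "Dom C c = Dom C a"
  shows "related a c"
  unfolding related_def
proof (rule locally_bind[OF ab[unfolded related_def]])
  fix u assume u: "u \<in> Ar C" "Cod C u = Dom C a" and l: "linked (a \<cdot> u) (b \<cdot> u)"
  have "related (b \<cdot> u) (c \<cdot> u)" by (rule related_restrict[OF bc]) (use A u in auto)
  then have "locally (Dom C u) (\<lambda>v. linked ((b \<cdot> u) \<cdot> v) ((c \<cdot> u) \<cdot> v))"
    unfolding related_def using A u by simp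
  then show "locally (Dom C u) (\<lambda>v. linked (a \<cdot> (u \<cdot> v)) (c \<cdot> (u \<cdot> v)))"
  proof (rule locally_bind)
    fix v assume v: "v \<in> Ar C" "Cod C v = Dom C u" and m: "linked ((b \<cdot> u) \<cdot> v) ((c \<cdot> u) \<cdot> v)"
    have "linked ((a \<cdot> u) \<cdot> v) ((b \<cdot> u) \<cdot> v)" by (rule linked_restrict[OF l]) (use A u v in auto)
    then have "locally (Dom C ((a \<cdot> u) \<cdot> v)) (\<lambda>w. linked (((a \<cdot> u) \<cdot> v) \<cdot> w) (((c \<cdot> u) \<cdot> v) \<cdot> w))"
      using m by (rule linked_trans)
    then have "locally (Dom C v) (\<lambda>w. linked (((a \<cdot> u) \<cdot> v) \<cdot> w) (((c \<cdot> u) \<cdot> v) \<cdot> w))"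
      using A u v by simp
    then show "locally (Dom C v) (\<lambda>w. linked (a \<cdot> (u \<cdot> (v \<cdot> w))) (c \<cdot> (u \<cdot> (v \<cdot> w))))"
      by (rule locally_mono) (use A u v in auto)
  qed
qed

text \<open>The representing subobject of \<open>s \<times> s\<close> is the joint image of the fibre products of \<open>ar G f\<close> and
  \<open>ar G g\<close> over all cospans \<open>(f, g)\<close> of \<open>J\<close>. A linked pair factors through one of these fibre
  products, so a related pair factors locally, and therefore globally, through the joint image.\<close>

lemma relation_representable:
  obtains r0 r1 where "r0 \<in> Ar C" "r1 \<in> Ar C" "Dom C r1 = Dom C r0" "Cod C r0 = s" "Cod C r1 = s"
    and "\<And>h k. \<lbrakk>h \<in> Ar C; k \<in> Ar C; Dom C h = Dom C k; Cod C h = Dom C r0; Cod C k = Dom C r0;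
      r0 \<cdot> h = r0 \<cdot> k; r1 \<cdot> h = r1 \<cdot> k\<rbrakk> \<Longrightarrow> h = k"
    and "\<And>a b. \<lbrakk>a \<in> Ar C; b \<in> Ar C; Dom C b = Dom C a; Cod C a = s; Cod C b = s\<rbrakk>
      \<Longrightarrow> related a b \<longleftrightarrow>
        (\<exists>h \<in> Ar C. Dom C h = Dom C a \<and> Cod C h = Dom C r0 \<and> r0 \<cdot> h = a \<and> r1 \<cdot> h = b)"
proof -
  obtain p q where pq [simp]: "p \<in> Ar C" "q \<in> Ar C" "Dom C q = Dom C p" "Cod C p = s" "Cod C q = s"
    and pair: "\<And>a b. \<lbrakk>a \<in> Ar C; b \<in> Ar C; Dom C b = Dom C a; Cod C a = s; Cod C b = s\<rbrakk>
      \<Longrightarrow> \<exists>h \<in> Ar C. Dom C h = Dom C a \<and> Cod C h = Dom C p \<and> p \<cdot> h = a \<and> q \<cdot> h = b"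
    and uniq: "\<And>h k. \<lbrakk>h \<in> Ar C; k \<in> Ar C; Dom C h = Dom C k; Cod C h = Dom C p; Cod C k = Dom C p;
      p \<cdot> h = p \<cdot> k; q \<cdot> h = q \<cdot> k\<rbrakk> \<Longrightarrow> h = k"
    using product_exists[OF s_Ob s_Ob] by blast
  \<comment> \<open>\<open>t\<close> maps the fibre product of \<open>ar G f\<close> and \<open>ar G g\<close> to \<open>s \<times> s\<close>.\<close>
  define good where "good f g x y t \<longleftrightarrow> is_pullback C (ar G f) (ar G g) x y \<and> t \<in> Ar C \<and>
    Dom C t = Dom C x \<and> Cod C t = Dom C p \<and> p \<cdot> t = inc (Dom J f) \<cdot> x \<and> q \<cdot> t = inc (Dom J g) \<cdot> y"
    for f g x y t
  define I where "I = {(f, g). f \<in> Ar J \<and> g \<in> Ar J \<and> Cod J g = Cod J f}"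
  have "\<exists>x y t. good f g x y t" if "(f, g) \<in> I" for f g
  proof -
    have fg: "f \<in> Ar J" "g \<in> Ar J" "Cod J g = Cod J f" using that by (auto simp: I_def)
    obtain x y where pb: "is_pullback C (ar G f) (ar G g) x y"
      using pullback_exists[of "ar G f" "ar G g"] fg by auto
    note [simp] = pullback_simps(1-8)[OF pb]
    obtain t where "t \<in> Ar C" "Dom C t = Dom C x" "Cod C t = Dom C p"
        "p \<cdot> t = inc (Dom J f) \<cdot> x" "q \<cdot> t = inc (Dom J g) \<cdot> y"
      using pair[of "inc (Dom J f) \<cdot> x" "inc (Dom J g) \<cdot> y"] fg by auto
    then show ?thesis using pb unfolding good_def by blast
  qed
  then have "\<exists>t. \<exists>x y. good (fst i) (snd i) x y t" if "i \<in> I" for i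
    using that by (metis prod.collapse)
  then obtain t where t: "\<And>i. i \<in> I \<Longrightarrow> \<exists>x y. good (fst i) (snd i) x y (t i)" by metis
  have ta: "t i \<in> Ar C" "Cod C (t i) = Dom C p" if "i \<in> I" for i
    using t[OF that] by (auto simp: good_def)
  have "I \<subseteq> Ar J \<times> Ar J" by (auto simp: I_def)
  then have "|I| <o r" using card_of_mono1 ordLeq_ordLess_trans small_Times[OF small_J small_J] by blast
  then have small: "|t ` I| <o r" by (rule small_image)
  have pOb: "Dom C p \<in> Ob C" by simp
  have tI: "t ` I \<subseteq> Ar C" "\<And>a. a \<in> t ` I \<Longrightarrow> Cod C a = Dom C p" using ta by auto
  obtain m where m: "is_mono C m" "Cod C m = Dom C p" "\<And>a. a \<in> t ` I \<Longrightarrow> sub_le C a m"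
      "locally (Dom C m) (\<lambda>w. m \<cdot> w \<in> t ` I)"
    using family_image[OF pOb tI small] by blast
  have ma [simp]: "m \<in> Ar C" using m by (simp add: is_mono_def)
  have linked_le: "sub_le C k m"
    if l: "linked (p \<cdot> k) (q \<cdot> k)" and k: "k \<in> Ar C" "Cod C k = Dom C p" for k
  proof -
    obtain f g x y where fg: "f \<in> Ar J" "g \<in> Ar J" and xy: "x \<in> Ar C" "y \<in> Ar C"
      and c: "Cod J g = Cod J f"
      and d: "Dom C x = Dom C (p \<cdot> k)" "Dom C y = Dom C (p \<cdot> k)"
        "Cod C x = ob G (Dom J f)" "Cod C y = ob G (Dom J g)"
      and e: "p \<cdot> k = inc (Dom J f) \<cdot> x" "q \<cdot> k = inc (Dom J g) \<cdot> y" "ar G f \<cdot> x = ar G g \<cdot> y"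
      using l by (rule linkedE)
    have d': "Dom C x = Dom C k" "Dom C y = Dom C k" using d k by auto
    have I: "(f, g) \<in> I" using fg c by (simp add: I_def)
    obtain x' y' where "good f g x' y' (t (f, g))" using t[OF I] by auto
    then have pb: "is_pullback C (ar G f) (ar G g) x' y'" and t': "Dom C (t (f, g)) = Dom C x'"
        "p \<cdot> t (f, g) = inc (Dom J f) \<cdot> x'" "q \<cdot> t (f, g) = inc (Dom J g) \<cdot> y'"
      by (auto simp: good_def)
    note pbs = pullback_simps(1-8)[OF pb]
    obtain h where h: "h \<in> Ar C" "Dom C h = Dom C x" "Cod C h = Dom C x'" "x' \<cdot> h = x" "y' \<cdot> h = y"
      by (rule pullback_lift[OF pb xy _ _ _ e(3)]) (use d d' fg in auto)
    have "p \<cdot> (t (f, g) \<cdot> h) = inc (Dom J f) \<cdot> (x' \<cdot> h)"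
      by (rule cmp_extend[OF t'(2)]) (use ta[OF I] t' pbs h fg in auto)
    moreover have "q \<cdot> (t (f, g) \<cdot> h) = inc (Dom J g) \<cdot> (y' \<cdot> h)"
      by (rule cmp_extend[OF t'(3)]) (use ta[OF I] t' pbs h fg in auto)
    ultimately have "t (f, g) \<cdot> h = k"
      using e(1,2) ta[OF I] t'(1) h d' k by - (rule uniq, auto)
    moreover have "sub_le C (t (f, g) \<cdot> h) m"
      by (rule sub_le_cmp) (use m(3) I h t'(1) in auto)
    ultimately show ?thesis by simp
  qed
  define r0 r1 where "r0 = p \<cdot> m" and "r1 = q \<cdot> m"
  have rs [simp]: "r0 \<in> Ar C" "r1 \<in> Ar C" "Dom C r0 = Dom C m" "Dom C r1 = Dom C m" "Cod C r0 = s" "Cod C r1 = s"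
    using m(2) by (auto simp: r0_def r1_def)
  have r0h: "r0 \<cdot> h = p \<cdot> (m \<cdot> h)" "r1 \<cdot> h = q \<cdot> (m \<cdot> h)" if "h \<in> Ar C" "Cod C h = Dom C m" for h
    using that m(2) by (auto simp: r0_def r1_def)
  have generic: "related r0 r1"
    unfolding related_def rs
  proof (rule locally_mono[OF m(4)])
    fix w assume w: "w \<in> Ar C" "Cod C w = Dom C m" and "m \<cdot> w \<in> t ` I"
    then obtain f g where I: "(f, g) \<in> I" and mw: "m \<cdot> w = t (f, g)" by auto
    obtain x y where "good f g x y (t (f, g))" using t[OF I] by auto
    then have pb: "is_pullback C (ar G f) (ar G g) x y" and
        t': "p \<cdot> t (f, g) = inc (Dom J f) \<cdot> x" "q \<cdot> t (f, g) = inc (Dom J g) \<cdot> y"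
      by (auto simp: good_def)
    note pbs = pullback_simps[OF pb]
    show "linked (r0 \<cdot> w) (r1 \<cdot> w)"
      unfolding r0h[OF w] mw t'
      by (rule linkedI[of f g x y]) (use I pbs in \<open>auto simp: I_def\<close>)
  qed
  show thesis
  proof (rule that[of r0 r1])
    fix h k assume hk: "h \<in> Ar C" "k \<in> Ar C" "Dom C h = Dom C k" "Cod C h = Dom C r0" "Cod C k = Dom C r0"
      "r0 \<cdot> h = r0 \<cdot> k" "r1 \<cdot> h = r1 \<cdot> k"
    then have "m \<cdot> h = m \<cdot> k" using m(2) r0h[of h] r0h[of k] by - (rule uniq, auto)
    then show "h = k" using hk by - (rule mono_cancel[OF m(1)], auto)
  next
    fix a b assume ab: "a \<in> Ar C" "b \<in> Ar C" "Dom C b = Dom C a" "Cod C a = s" "Cod C b = s"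
    show "related a b \<longleftrightarrow>
      (\<exists>h \<in> Ar C. Dom C h = Dom C a \<and> Cod C h = Dom C r0 \<and> r0 \<cdot> h = a \<and> r1 \<cdot> h = b)"
    proof
      assume rel: "related a b"
      obtain k where k: "k \<in> Ar C" "Dom C k = Dom C a" "Cod C k = Dom C p" "p \<cdot> k = a" "q \<cdot> k = b"
        using pair[OF ab] by blast
      have "locally (Dom C k) (\<lambda>u. sub_le C (k \<cdot> u) m)"
        unfolding k(2)
      proof (rule locally_mono[OF rel[unfolded related_def]])
        fix u assume u: "u \<in> Ar C" "Cod C u = Dom C a" and l: "linked (a \<cdot> u) (b \<cdot> u)"
        have "p \<cdot> (k \<cdot> u) = a \<cdot> u" "q \<cdot> (k \<cdot> u) = b \<cdot> u"
          using u k by (metis cmp_assoc' pq(1-3))+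
        then show "sub_le C (k \<cdot> u) m" using l u k by - (rule linked_le, auto)
      qed
      then have "sub_le C k m" using k m(1,2) by - (rule locally_factor, auto)
      then obtain h where h: "k = m \<cdot> h" "h \<in> Ar C" "Dom C h = Dom C k" "Cod C h = Dom C m"
        by (rule sub_leE)
      have "r0 \<cdot> h = a" "r1 \<cdot> h = b" using r0h[OF h(2,4)] k(4,5) h(1) by metis+
      then show "\<exists>h \<in> Ar C. Dom C h = Dom C a \<and> Cod C h = Dom C r0 \<and> r0 \<cdot> h = a \<and> r1 \<cdot> h = b"
        using h(2-4) k(2) by (intro bexI[of _ h]) auto
    next
      assume "\<exists>h \<in> Ar C. Dom C h = Dom C a \<and> Cod C h = Dom C r0 \<and> r0 \<cdot> h = a \<and> r1 \<cdot> h = b"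
      then obtain h where h: "h \<in> Ar C" "Cod C h = Dom C r0" "r0 \<cdot> h = a" "r1 \<cdot> h = b" by blast
      have "related (r0 \<cdot> h) (r1 \<cdot> h)" by (rule related_restrict[OF generic]) (use h in auto)
      then show "related a b" using h by simp
    qed
  qed auto
qed

text \<open>Exactness turns the relation into the kernel pair of a map out of the coproduct.\<close>

lemma quotient:
  obtains e where "e \<in> Ar C" "Dom C e = s"
    "\<And>a b. \<lbrakk>a \<in> Ar C; b \<in> Ar C; Dom C b = Dom C a; Cod C a = s; Cod C b = s\<rbrakk>
      \<Longrightarrow> e \<cdot> a = e \<cdot> b \<longleftrightarrow> related a b"
proof -
  obtain r0 r1 where rs [simp]: "r0 \<in> Ar C" "r1 \<in> Ar C" "Dom C r1 = Dom C r0" "Cod C r0 = s" "Cod C r1 = s"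
    and jm: "\<And>h k. \<lbrakk>h \<in> Ar C; k \<in> Ar C; Dom C h = Dom C k; Cod C h = Dom C r0; Cod C k = Dom C r0;
      r0 \<cdot> h = r0 \<cdot> k; r1 \<cdot> h = r1 \<cdot> k\<rbrakk> \<Longrightarrow> h = k"
    and rel: "\<And>a b. \<lbrakk>a \<in> Ar C; b \<in> Ar C; Dom C b = Dom C a; Cod C a = s; Cod C b = s\<rbrakk>
      \<Longrightarrow> related a b \<longleftrightarrow>
        (\<exists>h \<in> Ar C. Dom C h = Dom C a \<and> Cod C h = Dom C r0 \<and> r0 \<cdot> h = a \<and> r1 \<cdot> h = b)"
    using relation_representable by blast
  have generic: "related r0 r1"
    by (subst rel) (auto intro!: bexI[of _ "ident C (Dom C r0)"])
  have "is_equivalence_relation C s r0 r1"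
    unfolding is_equivalence_relation_def
  proof (intro conjI ballI allI impI)
    fix f g assume "f \<in> Ar C" "g \<in> Ar C" "Dom C f = Dom C g \<and> Cod C f = Dom C r0 \<and>
      Cod C g = Dom C r0 \<and> r0 \<cdot> f = r0 \<cdot> g \<and> r1 \<cdot> f = r1 \<cdot> g"
    then show "f = g" by - (rule jm, auto)
  next
    have "related (ident C s) (ident C s)" by (rule related_refl) auto
    then show "\<exists>d \<in> hom C s (Dom C r0). r0 \<cdot> d = ident C s \<and> r1 \<cdot> d = ident C s"
      using rel[of "ident C s" "ident C s"] by (auto simp: hom_def)
  next
    have "related r1 r0" by (rule related_sym[OF generic]) simp
    then show "\<exists>t \<in> hom C (Dom C r0) (Dom C r0). r0 \<cdot> t = r1 \<and> r1 \<cdot> t = r0"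
      using rel[of r1 r0] by (auto simp: hom_def)
  next
    fix p q assume pb: "is_pullback C r1 r0 p q"
    note [simp] = pullback_simps(3-4,6-8)[OF pb]
    have "related (r0 \<cdot> p) (r1 \<cdot> p)" "related (r0 \<cdot> q) (r1 \<cdot> q)"
      by (rule related_restrict[OF generic], auto)+
    then have "related (r0 \<cdot> p) (r1 \<cdot> q)"
      using pullback_simps(9)[OF pb] by - (rule related_trans[of "r0 \<cdot> p" "r1 \<cdot> p"], auto)
    then show "\<exists>t \<in> hom C (Dom C p) (Dom C r0). r0 \<cdot> t = r0 \<cdot> p \<and> r1 \<cdot> t = r1 \<cdot> q"
      using rel[of "r0 \<cdot> p" "r1 \<cdot> q"] by (auto simp: hom_def)
  qed auto
  then obtain e where ce: "is_coequalizer C r0 r1 e" and pb: "is_pullback C e e r0 r1"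
    using pretopos s_Ob unfolding pretopos_def barr_exact_category_def by metis
  have e [simp]: "e \<in> Ar C" "Dom C e = s" using ce by (auto simp: is_coequalizer_def)
  have er: "e \<cdot> r0 = e \<cdot> r1" using ce by (simp add: is_coequalizer_def)
  show thesis
  proof (rule that[of e])
    fix a b assume ab: "a \<in> Ar C" "b \<in> Ar C" "Dom C b = Dom C a" "Cod C a = s" "Cod C b = s"
    show "e \<cdot> a = e \<cdot> b \<longleftrightarrow> related a b"
    proof
      assume eq: "e \<cdot> a = e \<cdot> b"
      obtain h where "h \<in> Ar C" "Dom C h = Dom C a" "Cod C h = Dom C r0" "r0 \<cdot> h = a" "r1 \<cdot> h = b"
        by (rule pullback_lift[OF pb ab(1-3) _ _ eq]) (use ab in auto)
      then show "related a b" using rel[OF ab] by blast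
    next
      assume "related a b"
      then obtain h where h: "h \<in> Ar C" "Cod C h = Dom C r0" "r0 \<cdot> h = a" "r1 \<cdot> h = b"
        using rel[OF ab] by blast
      have "e \<cdot> (r0 \<cdot> h) = e \<cdot> (r1 \<cdot> h)"
        by (rule cmp_extend[OF er]) (use h in auto)
      then show "e \<cdot> a = e \<cdot> b" using h by simp
    qed
  qed auto
qed

text \<open>The quotient map restricts to a cocone, so it factors over the colimit, and an equation in the
  colimit gives one in the quotient.\<close>

lemma colimit_related:
  assumes col: "is_colimit J C G c \<gamma>" and ij: "i \<in> Ob J" "j \<in> Ob J"
    and x: "x \<in> Ar C" "Cod C x = ob G i" and y: "y \<in> Ar C" "Cod C y = ob G j" "Dom C y = Dom C x"
    and eq: "\<gamma> i \<cdot> x = \<gamma> j \<cdot> y"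
  shows "related (inc i \<cdot> x) (inc j \<cdot> y)"
proof -
  obtain e where e: "e \<in> Ar C" "Dom C e = s"
    and er: "\<And>a b. \<lbrakk>a \<in> Ar C; b \<in> Ar C; Dom C b = Dom C a; Cod C a = s; Cod C b = s\<rbrakk>
      \<Longrightarrow> e \<cdot> a = e \<cdot> b \<longleftrightarrow> related a b"
    using quotient by blast
  have "is_cocone J C G (Cod C e) (\<lambda>i. e \<cdot> inc i)"
    unfolding is_cocone_def
  proof (intro conjI ballI)
    fix f assume f: "f \<in> Ar J"
    have "linked ((inc (Cod J f) \<cdot> ar G f) \<cdot> ident C (ob G (Dom J f))) (inc (Dom J f) \<cdot> ident C (ob G (Dom J f)))"
      by (rule linkedI[of "ident J (Cod J f)" f "ar G f" "ident C (ob G (Dom J f))"]) (use f in auto)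
    then have "related (inc (Cod J f) \<cdot> ar G f) (inc (Dom J f))"
      unfolding related_def using f by (intro locally_here) auto
    then show "(e \<cdot> inc (Cod J f)) \<cdot> ar G f = e \<cdot> inc (Dom J f)"
      using er[of "inc (Cod J f) \<cdot> ar G f" "inc (Dom J f)"] e f by simp
  qed (use e in \<open>auto simp: hom_def\<close>)
  then obtain h where "h \<in> hom C c (Cod C e)" and h: "\<forall>i \<in> Ob J. h \<cdot> \<gamma> i = e \<cdot> inc i"
    using col unfolding is_colimit_def by metis
  then have ha: "h \<in> Ar C" "Dom C h = c" by (auto simp: hom_def)
  have g: "\<gamma> i \<in> Ar C" "Cod C (\<gamma> i) = c" "Dom C (\<gamma> i) = ob G i" if "i \<in> Ob J" for i
    using col that by (auto simp: is_colimit_def is_cocone_def hom_def)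
  have "e \<cdot> (inc i \<cdot> x) = h \<cdot> (\<gamma> i \<cdot> x)"
    by (rule cmp_extend) (use h ij g x e ha in auto)
  also have "\<dots> = h \<cdot> (\<gamma> j \<cdot> y)" by (simp only: eq)
  also have "\<dots> = e \<cdot> (inc j \<cdot> y)"
    by (rule cmp_extend) (use h ij g y e ha in auto)
  finally show ?thesis using er ij x y by simp
qed

text \<open>The two elements are related in the coproduct. Disjointness discards links that start or end
  in a summand other than \<open>i\<close>. The remaining links consist of parallel arrows of \<open>J\<close>, since the
  injections are monic, and filteredness coequalises them.\<close>

lemma colimit_identifies_locally:
  assumes col: "is_colimit J C G c \<gamma>" and i: "i \<in> Ob J"
    and x: "x \<in> Ar C" "Cod C x = ob G i" and y: "y \<in> Ar C" "Cod C y = ob G i" "Dom C y = Dom C x"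
    and eq: "\<gamma> i \<cdot> x = \<gamma> i \<cdot> y"
  shows "locally (Dom C x) (\<lambda>u. \<exists>f \<in> Ar J. Dom J f = i \<and> ar G f \<cdot> (x \<cdot> u) = ar G f \<cdot> (y \<cdot> u))"
proof -
  let ?Q = "\<lambda>u. \<exists>f \<in> Ar J. Dom J f = i \<and> ar G f \<cdot> (x \<cdot> u) = ar G f \<cdot> (y \<cdot> u)"
  have "locally (Dom C x) (\<lambda>u. linked ((inc i \<cdot> x) \<cdot> u) ((inc i \<cdot> y) \<cdot> u))"
    using colimit_related[OF col i i x y eq] x i by (simp add: related_def)
  then show ?thesis
  proof (rule locally_bind)
    fix u assume u: "u \<in> Ar C" "Cod C u = Dom C x" and l: "linked ((inc i \<cdot> x) \<cdot> u) ((inc i \<cdot> y) \<cdot> u)"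
    obtain f g p q where fg: "f \<in> Ar J" "g \<in> Ar J" "p \<in> Ar C" "q \<in> Ar C" "Cod J g = Cod J f"
      and d: "Dom C p = Dom C ((inc i \<cdot> x) \<cdot> u)" "Dom C q = Dom C ((inc i \<cdot> x) \<cdot> u)"
      and c: "Cod C p = ob G (Dom J f)" "Cod C q = ob G (Dom J g)"
      and e: "(inc i \<cdot> x) \<cdot> u = inc (Dom J f) \<cdot> p" "(inc i \<cdot> y) \<cdot> u = inc (Dom J g) \<cdot> q"
        "ar G f \<cdot> p = ar G g \<cdot> q"
      using l by (rule linkedE)
    have d': "Dom C p = Dom C u" "Dom C q = Dom C u" using d i x u by auto
    have ep: "inc i \<cdot> (x \<cdot> u) = inc (Dom J f) \<cdot> p" and eq: "inc i \<cdot> (y \<cdot> u) = inc (Dom J g) \<cdot> q"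
      using e i x y u by auto
    have xu: "x \<cdot> u \<in> Ar C" "Cod C (x \<cdot> u) = ob G i" "Dom C (x \<cdot> u) = Dom C u"
      "y \<cdot> u \<in> Ar C" "Cod C (y \<cdot> u) = ob G i" "Dom C (y \<cdot> u) = Dom C u" using x y u by auto
    consider "Dom J f \<noteq> i" | "Dom J g \<noteq> i" | "Dom J f = i" "Dom J g = i" by blast
    then show "locally (Dom C u) (\<lambda>v. ?Q (u \<cdot> v))"
    proof cases
      case 1
      have "locally (Dom C (x \<cdot> u)) (\<lambda>v. ?Q (u \<cdot> v))"
        by (rule locally_disjoint_summands[OF i _ 1[symmetric] xu(1,2) fg(3) c(1) _ ep]) (use fg d' xu in auto)
      then show ?thesis using xu by simp
    next
      case 2
      have "locally (Dom C (y \<cdot> u)) (\<lambda>v. ?Q (u \<cdot> v))"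
        by (rule locally_disjoint_summands[OF i _ 2[symmetric] xu(4,5) fg(4) c(2) _ eq]) (use fg d' xu in auto)
      then show ?thesis using xu by simp
    next
      case 3
      have p: "x \<cdot> u = p" by (rule mono_cancel[OF inc_mono[OF i]]) (use ep 3 xu fg c d' i in auto)
      have q: "y \<cdot> u = q" by (rule mono_cancel[OF inc_mono[OF i]]) (use eq 3 xu fg c d' i in auto)
      obtain h where h: "h \<in> Ar J" "Dom J h = Cod J f" "h \<cdot>\<^bsub>J\<^esub> f = h \<cdot>\<^bsub>J\<^esub> g"
        using coequalise[of f g] fg 3 by auto
      have "ar G (h \<cdot>\<^bsub>J\<^esub> f) \<cdot> (x \<cdot> u) = ar G h \<cdot> (ar G f \<cdot> (x \<cdot> u))"
        using h(1,2) fg xu 3 by simp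
      also have "\<dots> = ar G h \<cdot> (ar G g \<cdot> (y \<cdot> u))" using e(3) p q by simp
      also have "\<dots> = ar G (h \<cdot>\<^bsub>J\<^esub> g) \<cdot> (y \<cdot> u)" using h(1,2) fg xu 3 by simp
      finally have *: "ar G (h \<cdot>\<^bsub>J\<^esub> f) \<cdot> (x \<cdot> u) = ar G (h \<cdot>\<^bsub>J\<^esub> f) \<cdot> (y \<cdot> u)" by (simp only: h(3))
      have "?Q (u \<cdot> ident C (Dom C u))"
        using * h(1,2) fg 3 u by (intro bexI[of _ "h \<cdot>\<^bsub>J\<^esub> f"]) auto
      then show ?thesis using u by (intro locally_here) auto
    qed
  qed
qed

end

context small_filtered_diagram
begin

text \<open>The same conclusion without reference to a chosen coproduct of the diagram.\<close>

lemma colimit_identifies: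
  assumes "is_colimit J C G c \<gamma>" "i \<in> Ob J" "x \<in> Ar C" "Cod C x = ob G i"
    "y \<in> Ar C" "Cod C y = ob G i" "Dom C y = Dom C x" "\<gamma> i \<cdot> x = \<gamma> i \<cdot> y"
  shows "locally (Dom C x) (\<lambda>u. \<exists>f \<in> Ar J. Dom J f = i \<and> ar G f \<cdot> (x \<cdot> u) = ar G f \<cdot> (y \<cdot> u))"
proof -
  obtain s inc where "is_coproduct C (Ob J) (ob G) s inc" "disjoint_injections C (Ob J) inc"
    using small_coproduct[OF small_Ob_J, of "ob G"] by auto
  then interpret diagram_coproduct C r J G s inc by unfold_locales
  show ?thesis using assms by (rule colimit_identifies_locally)
qed

text \<open>A subobject through which all coprojections factor carries a cocone, and the induced map from
  the colimit is a section of its inclusion.\<close>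

lemma locally_in_stage:
  assumes col: "is_colimit J C G c \<gamma>"
  shows "locally c (\<lambda>u. u \<in> \<gamma> ` Ob J)"
proof (rule locally_member)
  have c: "c \<in> Ob C" and g: "\<And>i. i \<in> Ob J \<Longrightarrow> \<gamma> i \<in> Ar C \<and> Cod C (\<gamma> i) = c \<and> Dom C (\<gamma> i) = ob G i"
    and nat: "\<And>f. f \<in> Ar J \<Longrightarrow> \<gamma> (Cod J f) \<cdot> ar G f = \<gamma> (Dom J f)"
    using col by (auto simp: is_colimit_def is_cocone_def hom_def)
  show "c \<in> Ob C" "\<gamma> ` Ob J \<subseteq> Ar C" "\<And>a. a \<in> \<gamma> ` Ob J \<Longrightarrow> Cod C a = c" using c g by auto
  show "|\<gamma> ` Ob J| <o r" by (rule small_image[OF small_Ob_J])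
  fix m assume m: "is_mono C m" "Cod C m = c" and le: "\<forall>a \<in> \<gamma> ` Ob J. sub_le C a m"
  have ma: "m \<in> Ar C" using m by (simp add: is_mono_def)
  have "\<forall>i \<in> Ob J. \<exists>t. t \<in> Ar C \<and> Dom C t = ob G i \<and> Cod C t = Dom C m \<and> \<gamma> i = m \<cdot> t"
    using le g by (auto simp: sub_le_def hom_def)
  then obtain t where t: "\<And>i. i \<in> Ob J \<Longrightarrow> t i \<in> Ar C \<and> Dom C (t i) = ob G i \<and> Cod C (t i) = Dom C m"
      "\<And>i. i \<in> Ob J \<Longrightarrow> m \<cdot> t i = \<gamma> i"
    by metis
  have "is_cocone J C G (Dom C m) t"
    unfolding is_cocone_def
  proof (intro conjI ballI)
    fix f assume f: "f \<in> Ar J"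
    have "m \<cdot> (t (Cod J f) \<cdot> ar G f) = \<gamma> (Cod J f) \<cdot> ar G f"
      using t(1)[of "Cod J f"] t(2)[of "Cod J f", symmetric] f ma by simp
    then have "m \<cdot> (t (Cod J f) \<cdot> ar G f) = m \<cdot> t (Dom J f)" using nat[OF f] t(2) f by simp
    then show "t (Cod J f) \<cdot> ar G f = t (Dom J f)"
      using t(1) f ma by - (rule mono_cancel[OF m(1)], auto)
  qed (use t(1) ma in \<open>auto simp: hom_def\<close>)
  then obtain h where "h \<in> hom C c (Dom C m)" and ht: "\<forall>i \<in> Ob J. h \<cdot> \<gamma> i = t i"
    using col unfolding is_colimit_def by metis
  then have h: "h \<in> Ar C" "Dom C h = c" "Cod C h = Dom C m" by (auto simp: hom_def)
  have "ident C c = m \<cdot> h"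
  proof (rule colimit_ext[OF col functor_G J.category_axioms])
    fix i assume i: "i \<in> Ob J"
    show "ident C c \<cdot> \<gamma> i = (m \<cdot> h) \<cdot> \<gamma> i" using i h ht t(2) g ma by simp
  qed (use h m ma c in auto)
  then show "sub_le C (ident C c) m" by (rule sub_leI) (use h c in auto)
qed

lemma locally_lift:
  assumes col: "is_colimit J C G c \<gamma>" and z: "z \<in> Ar C" "Cod C z = c"
  shows "locally (Dom C z) (\<lambda>v. \<exists>i \<in> Ob J. \<exists>y \<in> Ar C. Dom C y = Dom C v \<and> Cod C y = ob G i \<and> \<gamma> i \<cdot> y = z \<cdot> v)"
proof (rule locally_mono[OF locally_pullback[OF locally_in_stage[OF col] z]])
  fix v assume "\<exists>u \<in> Ar C. \<exists>h \<in> Ar C. u \<in> \<gamma> ` Ob J \<and> Cod C u = c \<and>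
      Dom C h = Dom C v \<and> Cod C h = Dom C u \<and> z \<cdot> v = u \<cdot> h"
  moreover have "Dom C (\<gamma> i) = ob G i" if "i \<in> Ob J" for i
    using col that by (auto simp: is_colimit_def is_cocone_def hom_def)
  ultimately obtain i h where "i \<in> Ob J" "h \<in> Ar C" "Dom C h = Dom C v" "Cod C h = ob G i" "\<gamma> i \<cdot> h = z \<cdot> v"
    by auto
  then show "\<exists>i \<in> Ob J. \<exists>y \<in> Ar C. Dom C y = Dom C v \<and> Cod C y = ob G i \<and> \<gamma> i \<cdot> y = z \<cdot> v"
    by blast
qed

end


section \<open>Commutation of filtered colimits with finite limits\<close>

locale limit_colimit_square = lambda_pretopos + J: category J + K: category K
  for J :: "('i, 'j) cat" and K :: "('k, 'n) cat" +
  fixes F L \<pi> M \<iota> c \<gamma> l \<delta>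
  assumes filtered: "filtered_category J" and small_J: "|Ar J| <o r" and finite_K: "finite (Ar K)"
    and functor_F: "is_functor (prod_cat J K) C F"
    and lim_L: "is_limit_functor J K C F L \<pi>"
    and colim_M: "is_colimit_functor J K C F M \<iota>"
    and colim_L: "is_colimit J C L c \<gamma>"
    and lim_M: "is_limit K C M l \<delta>"
begin

lemma F_simps [simp]:
  assumes "f \<in> Ar J" "g \<in> Ar K"
  shows "ar F (f, g) \<in> Ar C" "Dom C (ar F (f, g)) = ob F (Dom J f, Dom K g)"
    "Cod C (ar F (f, g)) = ob F (Cod J f, Cod K g)"
  using functor_F assms by (auto simp: is_functor_def prod_cat_def hom_def)

lemma F_Ob [simp]: "\<lbrakk>j \<in> Ob J; k \<in> Ob K\<rbrakk> \<Longrightarrow> ob F (j, k) \<in> Ob C"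
  using functor_F by (auto simp: is_functor_def prod_cat_def)

lemma F_ident [simp]:
  "\<lbrakk>j \<in> Ob J; k \<in> Ob K\<rbrakk> \<Longrightarrow> ar F (ident J j, ident K k) = ident C (ob F (j, k))"
  using functor_F by (auto simp: is_functor_def prod_cat_def)

lemma F_cmp:
  assumes "f \<in> Ar J" "f' \<in> Ar J" "g \<in> Ar K" "g' \<in> Ar K" "Dom J f' = Cod J f" "Dom K g' = Cod K g"
  shows "ar F (f', g') \<cdot> ar F (f, g) = ar F (f' \<cdot>\<^bsub>J\<^esub> f, g' \<cdot>\<^bsub>K\<^esub> g)"
  using functor_F assms by (auto simp: is_functor_def prod_cat_def)

lemma finite_Ob_K: "finite (Ob K)"
proof -
  have "Ob K \<subseteq> Dom K ` Ar K" using K.ident_simps by (metis image_eqI subsetI)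
  then show ?thesis using finite_K by (meson finite_imageI finite_subset)
qed

lemma functor_fix_fst: "j \<in> Ob J \<Longrightarrow> is_functor K C (fix_fst J F j)"
  by (auto simp: is_functor_def fix_fst_def hom_def F_cmp)

lemma functor_fix_snd: "k \<in> Ob K \<Longrightarrow> is_functor J C (fix_snd K F k)"
  by (auto simp: is_functor_def fix_snd_def hom_def F_cmp)

lemma functor_L: "is_functor J C L" and functor_M: "is_functor K C M"
  using lim_L colim_M by (auto simp: is_limit_functor_def is_colimit_functor_def)

lemma lim_at: "j \<in> Ob J \<Longrightarrow> is_limit K C (fix_fst J F j) (ob L j) (\<pi> j)"
  using lim_L by (simp add: is_limit_functor_def)

lemma colim_at: "k \<in> Ob K \<Longrightarrow> is_colimit J C (fix_snd K F k) (ob M k) (\<lambda>j. \<iota> j k)"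
  using colim_M by (simp add: is_colimit_functor_def)

lemma diagram_at: "k \<in> Ob K \<Longrightarrow> small_filtered_diagram C r J (fix_snd K F k)"
  using filtered small_J functor_fix_snd by unfold_locales

lemma diagram_L: "small_filtered_diagram C r J L"
  using filtered small_J functor_L by unfold_locales

lemma projection_simps [simp]:
  assumes "j \<in> Ob J" "k \<in> Ob K"
  shows "\<pi> j k \<in> Ar C" "Dom C (\<pi> j k) = ob L j" "Cod C (\<pi> j k) = ob F (j, k)"
  using lim_at[OF assms(1)] assms by (auto simp: is_limit_def is_cone_def fix_fst_def hom_def)

lemma projection_natural:
  assumes "f \<in> Ar J" "k \<in> Ob K"
  shows "ar F (f, ident K k) \<cdot> \<pi> (Dom J f) k = \<pi> (Cod J f) k \<cdot> ar L f"
  using lim_L assms by (simp add: is_limit_functor_def)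

lemma coprojection_simps [simp]:
  assumes "j \<in> Ob J" "k \<in> Ob K"
  shows "\<iota> j k \<in> Ar C" "Dom C (\<iota> j k) = ob F (j, k)" "Cod C (\<iota> j k) = ob M k"
  using colim_at[OF assms(2)] assms by (auto simp: is_colimit_def is_cocone_def fix_snd_def hom_def)

lemma coprojection_cocone:
  assumes "f \<in> Ar J" "k \<in> Ob K"
  shows "\<iota> (Cod J f) k \<cdot> ar F (f, ident K k) = \<iota> (Dom J f) k"
  using colim_at[OF assms(2)] assms by (auto simp: is_colimit_def is_cocone_def fix_snd_def)

lemma coprojection_natural:
  assumes "j \<in> Ob J" "g \<in> Ar K"
  shows "ar M g \<cdot> \<iota> j (Dom K g) = \<iota> j (Cod K g) \<cdot> ar F (ident J j, g)"
  using colim_M assms by (simp add: is_colimit_functor_def)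

lemma L_simps [simp]:
  "j \<in> Ob J \<Longrightarrow> ob L j \<in> Ob C"
  "f \<in> Ar J \<Longrightarrow> ar L f \<in> Ar C"
  "f \<in> Ar J \<Longrightarrow> Dom C (ar L f) = ob L (Dom J f)"
  "f \<in> Ar J \<Longrightarrow> Cod C (ar L f) = ob L (Cod J f)"
  using functor_L by (auto simp: is_functor_def hom_def)

lemma M_simps [simp]:
  "k \<in> Ob K \<Longrightarrow> ob M k \<in> Ob C"
  "g \<in> Ar K \<Longrightarrow> ar M g \<in> Ar C"
  "g \<in> Ar K \<Longrightarrow> Dom C (ar M g) = ob M (Dom K g)"
  "g \<in> Ar K \<Longrightarrow> Cod C (ar M g) = ob M (Cod K g)"
  using functor_M by (auto simp: is_functor_def hom_def)

lemma \<gamma>_simps [simp]: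
  "j \<in> Ob J \<Longrightarrow> \<gamma> j \<in> Ar C" "j \<in> Ob J \<Longrightarrow> Dom C (\<gamma> j) = ob L j" "j \<in> Ob J \<Longrightarrow> Cod C (\<gamma> j) = c"
  using colim_L by (auto simp: is_colimit_def is_cocone_def hom_def)

lemma \<gamma>_cocone: "f \<in> Ar J \<Longrightarrow> \<gamma> (Cod J f) \<cdot> ar L f = \<gamma> (Dom J f)"
  using colim_L by (auto simp: is_colimit_def is_cocone_def)

lemma \<gamma>_advance:
  assumes "f \<in> Ar J" "t \<in> Ar C" "Cod C t = ob L (Dom J f)"
  shows "\<gamma> (Cod J f) \<cdot> (ar L f \<cdot> t) = \<gamma> (Dom J f) \<cdot> t"
  using assms \<gamma>_cocone[of f] by (simp flip: cmp_assoc')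

lemma \<delta>_simps [simp]:
  "l \<in> Ob C" "k \<in> Ob K \<Longrightarrow> \<delta> k \<in> Ar C" "k \<in> Ob K \<Longrightarrow> Dom C (\<delta> k) = l" "k \<in> Ob K \<Longrightarrow> Cod C (\<delta> k) = ob M k"
  using lim_M by (auto simp: is_limit_def is_cone_def hom_def)

lemma \<delta>_cone: "g \<in> Ar K \<Longrightarrow> ar M g \<cdot> \<delta> (Dom K g) = \<delta> (Cod K g)"
  using lim_M by (auto simp: is_limit_def is_cone_def)

lemma advance:
  assumes "f \<in> Ar J" "f' \<in> Ar J" "Dom J f' = Cod J f" "k \<in> Ob K" "x \<in> Ar C" "Cod C x = ob F (Dom J f, k)"
  shows "ar F (f' \<cdot>\<^bsub>J\<^esub> f, ident K k) \<cdot> x = ar F (f', ident K k) \<cdot> (ar F (f, ident K k) \<cdot> x)"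
  using assms F_cmp[of f f' "ident K k" "ident K k"] by (simp flip: cmp_assoc')

lemma advance_coprojection:
  assumes "f \<in> Ar J" "k \<in> Ob K" "x \<in> Ar C" "Cod C x = ob F (Dom J f, k)"
  shows "\<iota> (Cod J f) k \<cdot> (ar F (f, ident K k) \<cdot> x) = \<iota> (Dom J f) k \<cdot> x"
  using assms coprojection_cocone[of f k] by (simp flip: cmp_assoc')

lemma amalgamate:
  assumes "f \<in> Ar J" "g \<in> Ar J" "Dom J f = Dom J g"
  obtains f' g' where "f' \<in> Ar J" "g' \<in> Ar J" "Dom J f' = Cod J f" "Dom J g' = Cod J g"
    "Cod J g' = Cod J f'" "f' \<cdot>\<^bsub>J\<^esub> f = g' \<cdot>\<^bsub>J\<^esub> g"
  using small_filtered_diagram.amalgamate[OF diagram_L assms] by blast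

lemma bound:
  assumes "x \<in> Ob J" "y \<in> Ob J"
  obtains f g where "f \<in> Ar J" "g \<in> Ar J" "Dom J f = x" "Dom J g = y" "Cod J g = Cod J f"
  using small_filtered_diagram.bound[OF diagram_L assms] by blast

text \<open>Each identification is visible at some stage on some cover; finitely many covers have a common
  refinement and finitely many stages a common bound. The entries are indexed by an arbitrary finite
  set \<open>A\<close> because the objects of \<open>K\<close> serve to compare two elements of a limit, while the arrows of \<open>K\<close>
  serve to compare the two sides of the matching conditions.\<close>

lemma identify_finitely_many:
  assumes A: "finite A" and j: "j \<in> Ob J" and T: "T \<in> Ob C"
    and k: "\<And>a. a \<in> A \<Longrightarrow> k a \<in> Ob K"
    and x: "\<And>a. a \<in> A \<Longrightarrow> x a \<in> Ar C \<and> Dom C (x a) = T \<and> Cod C (x a) = ob F (j, k a)"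
    and y: "\<And>a. a \<in> A \<Longrightarrow> y a \<in> Ar C \<and> Dom C (y a) = T \<and> Cod C (y a) = ob F (j, k a)"
    and eq: "\<And>a. a \<in> A \<Longrightarrow> \<iota> j (k a) \<cdot> x a = \<iota> j (k a) \<cdot> y a"
  shows "locally T (\<lambda>u. \<exists>f \<in> Ar J. Dom J f = j \<and>
    (\<forall>a \<in> A. ar F (f, ident K (k a)) \<cdot> (x a \<cdot> u) = ar F (f, ident K (k a)) \<cdot> (y a \<cdot> u)))"
  using A k x y eq
proof (induction A rule: finite_induct)
  case empty
  show ?case using j T by (intro locally_here) (auto intro!: bexI[of _ "ident J j"])
next
  case (insert b A)
  note kb = insert.prems(1)[OF insertI1] and xb = insert.prems(2)[OF insertI1]
    and yb = insert.prems(3)[OF insertI1] and eqb = insert.prems(4)[OF insertI1]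
  note kA = insert.prems(1)[OF insertI2] and xA = insert.prems(2)[OF insertI2]
    and yA = insert.prems(3)[OF insertI2] and eqA = insert.prems(4)[OF insertI2]
  show ?case
  proof (rule locally_bind[OF insert.IH[OF kA xA yA eqA]])
    fix u assume u: "u \<in> Ar C" "Cod C u = T" and "\<exists>f \<in> Ar J. Dom J f = j \<and>
      (\<forall>a \<in> A. ar F (f, ident K (k a)) \<cdot> (x a \<cdot> u) = ar F (f, ident K (k a)) \<cdot> (y a \<cdot> u))"
    then obtain f where f: "f \<in> Ar J" "Dom J f = j"
      and fA: "\<And>a. a \<in> A \<Longrightarrow> ar F (f, ident K (k a)) \<cdot> (x a \<cdot> u) = ar F (f, ident K (k a)) \<cdot> (y a \<cdot> u)"
      by blast
    have xu: "x b \<cdot> u \<in> Ar C" "Cod C (x b \<cdot> u) = ob (fix_snd K F (k b)) j" "Dom C (x b \<cdot> u) = Dom C u"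
      using xb u by (auto simp: fix_snd_def)
    have yu: "y b \<cdot> u \<in> Ar C" "Cod C (y b \<cdot> u) = ob (fix_snd K F (k b)) j" "Dom C (y b \<cdot> u) = Dom C (x b \<cdot> u)"
      using xb yb u by (auto simp: fix_snd_def)
    have eu: "\<iota> j (k b) \<cdot> (x b \<cdot> u) = \<iota> j (k b) \<cdot> (y b \<cdot> u)"
      by (rule cmp_extend[OF eqb]) (use xb yb u j kb in auto)
    have "locally (Dom C u) (\<lambda>v. \<exists>g \<in> Ar J. Dom J g = j \<and>
        ar F (g, ident K (k b)) \<cdot> ((x b \<cdot> u) \<cdot> v) = ar F (g, ident K (k b)) \<cdot> ((y b \<cdot> u) \<cdot> v))"
      using small_filtered_diagram.colimit_identifies[OF diagram_at[OF kb] colim_at[OF kb] j xu(1,2) yu eu] xu(3)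
      by (simp add: fix_snd_def)
    then show "locally (Dom C u) (\<lambda>v. \<exists>h \<in> Ar J. Dom J h = j \<and> (\<forall>a \<in> insert b A.
        ar F (h, ident K (k a)) \<cdot> (x a \<cdot> (u \<cdot> v)) = ar F (h, ident K (k a)) \<cdot> (y a \<cdot> (u \<cdot> v))))"
    proof (rule locally_mono)
      fix v assume v: "v \<in> Ar C" "Cod C v = Dom C u" and "\<exists>g \<in> Ar J. Dom J g = j \<and>
        ar F (g, ident K (k b)) \<cdot> ((x b \<cdot> u) \<cdot> v) = ar F (g, ident K (k b)) \<cdot> ((y b \<cdot> u) \<cdot> v)"
      then obtain g where g: "g \<in> Ar J" "Dom J g = j"
        and gb: "ar F (g, ident K (k b)) \<cdot> (x b \<cdot> (u \<cdot> v)) = ar F (g, ident K (k b)) \<cdot> (y b \<cdot> (u \<cdot> v))"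
        using xb yb u v by auto
      obtain f' g' where fg: "f' \<in> Ar J" "g' \<in> Ar J" "Dom J f' = Cod J f" "Dom J g' = Cod J g"
          "Cod J g' = Cod J f'" "f' \<cdot>\<^bsub>J\<^esub> f = g' \<cdot>\<^bsub>J\<^esub> g"
        using amalgamate[OF f(1) g(1)] f g by metis
      have "ar F (f' \<cdot>\<^bsub>J\<^esub> f, ident K (k a)) \<cdot> (x a \<cdot> (u \<cdot> v)) = ar F (f' \<cdot>\<^bsub>J\<^esub> f, ident K (k a)) \<cdot> (y a \<cdot> (u \<cdot> v))"
        if a: "a \<in> insert b A" for a
      proof (cases "a = b")
        case True
        show ?thesis
          unfolding True fg(6) using gb g fg(1-5) kb xb yb u v by (simp add: advance)
      next
        case False
        then have a: "a \<in> A" using a by simp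
        have "ar F (f, ident K (k a)) \<cdot> ((x a \<cdot> u) \<cdot> v) = ar F (f, ident K (k a)) \<cdot> ((y a \<cdot> u) \<cdot> v)"
          by (rule cmp_extend[OF fA[OF a]]) (use xA[OF a] yA[OF a] kA[OF a] f u v in auto)
        then show ?thesis
          using f fg(1-5) kA[OF a] xA[OF a] yA[OF a] u v by (simp add: advance)
      qed
      then show "\<exists>h \<in> Ar J. Dom J h = j \<and> (\<forall>a \<in> insert b A.
          ar F (h, ident K (k a)) \<cdot> (x a \<cdot> (u \<cdot> v)) = ar F (h, ident K (k a)) \<cdot> (y a \<cdot> (u \<cdot> v)))"
        using f fg(1-5) by (intro bexI[of _ "f' \<cdot>\<^bsub>J\<^esub> f"]) auto
    qed
  qed
qed

text \<open>Lift the elements one after the other, refining the cover and advancing the stage each time.\<close>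

lemma lift_finitely_many:
  assumes A: "finite A" "A \<subseteq> Ob K" and T: "T \<in> Ob C"
    and z: "\<And>k. k \<in> A \<Longrightarrow> z k \<in> Ar C \<and> Dom C (z k) = T \<and> Cod C (z k) = ob M k"
  shows "locally T (\<lambda>u. \<exists>j \<in> Ob J. \<exists>x. \<forall>k \<in> A.
    x k \<in> Ar C \<and> Dom C (x k) = Dom C u \<and> Cod C (x k) = ob F (j, k) \<and> \<iota> j k \<cdot> x k = z k \<cdot> u)"
  using A z
proof (induction A rule: finite_induct)
  case empty
  obtain j where "j \<in> Ob J" using filtered by (auto simp: filtered_category_def)
  then show ?case using T by (intro locally_here) auto
next
  case (insert b A)
  have bK: "b \<in> Ob K" and AK: "A \<subseteq> Ob K" using insert.prems(1) by auto
  note zb = insert.prems(2)[OF insertI1] and zA = insert.prems(2)[OF insertI2]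
  show ?case
  proof (rule locally_bind[OF insert.IH[OF AK zA]])
    fix u assume u: "u \<in> Ar C" "Cod C u = T" and "\<exists>j \<in> Ob J. \<exists>x. \<forall>k \<in> A.
      x k \<in> Ar C \<and> Dom C (x k) = Dom C u \<and> Cod C (x k) = ob F (j, k) \<and> \<iota> j k \<cdot> x k = z k \<cdot> u"
    then obtain j x where j: "j \<in> Ob J" and x: "\<And>k. k \<in> A \<Longrightarrow>
      x k \<in> Ar C \<and> Dom C (x k) = Dom C u \<and> Cod C (x k) = ob F (j, k) \<and> \<iota> j k \<cdot> x k = z k \<cdot> u"
      by blast
    have zu: "z b \<cdot> u \<in> Ar C" "Cod C (z b \<cdot> u) = ob M b" "Dom C (z b \<cdot> u) = Dom C u"
      using zb u by auto
    have "locally (Dom C u) (\<lambda>v. \<exists>i \<in> Ob J. \<exists>y \<in> Ar C. Dom C y = Dom C v \<and> Cod C y = ob F (i, b) \<and>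
        \<iota> i b \<cdot> y = (z b \<cdot> u) \<cdot> v)"
      using small_filtered_diagram.locally_lift[OF diagram_at[OF bK] colim_at[OF bK] zu(1,2)] zu(3)
      by (simp add: fix_snd_def)
    then show "locally (Dom C u) (\<lambda>v. \<exists>j \<in> Ob J. \<exists>x. \<forall>k \<in> insert b A.
        x k \<in> Ar C \<and> Dom C (x k) = Dom C (u \<cdot> v) \<and> Cod C (x k) = ob F (j, k) \<and> \<iota> j k \<cdot> x k = z k \<cdot> (u \<cdot> v))"
    proof (rule locally_mono)
      fix v assume v: "v \<in> Ar C" "Cod C v = Dom C u" and "\<exists>i \<in> Ob J. \<exists>y \<in> Ar C. Dom C y = Dom C v \<and>
        Cod C y = ob F (i, b) \<and> \<iota> i b \<cdot> y = (z b \<cdot> u) \<cdot> v"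
      then obtain i y where i: "i \<in> Ob J" and y: "y \<in> Ar C" "Dom C y = Dom C v" "Cod C y = ob F (i, b)"
          "\<iota> i b \<cdot> y = z b \<cdot> (u \<cdot> v)"
        using zb u by auto
      obtain f g where fg: "f \<in> Ar J" "g \<in> Ar J" "Dom J f = j" "Dom J g = i" "Cod J g = Cod J f"
        using bound[OF j i] by blast
      define w where "w k = (if k = b then ar F (g, ident K b) \<cdot> y else ar F (f, ident K k) \<cdot> (x k \<cdot> v))" for k
      have "w k \<in> Ar C \<and> Dom C (w k) = Dom C (u \<cdot> v) \<and> Cod C (w k) = ob F (Cod J f, k) \<and>
        \<iota> (Cod J f) k \<cdot> w k = z k \<cdot> (u \<cdot> v)" if k: "k \<in> insert b A" for k
      proof (cases "k = b")
        case True
        have "\<iota> (Cod J f) b \<cdot> (ar F (g, ident K b) \<cdot> y) = z b \<cdot> (u \<cdot> v)"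
          using advance_coprojection[of g b y] fg y bK by simp
        then show ?thesis using True y fg bK u v by (simp add: w_def)
      next
        case False
        then have kA: "k \<in> A" and kK: "k \<in> Ob K" using k AK by auto
        have "\<iota> j k \<cdot> (x k \<cdot> v) = z k \<cdot> (u \<cdot> v)"
          by (rule cmp_extend) (use x[OF kA] zA[OF kA] u v j kK in auto)
        then have "\<iota> (Cod J f) k \<cdot> (ar F (f, ident K k) \<cdot> (x k \<cdot> v)) = z k \<cdot> (u \<cdot> v)"
          using advance_coprojection[of f k "x k \<cdot> v"] fg x[OF kA] v kK by simp
        then show ?thesis using False x[OF kA] fg kK u v by (simp add: w_def)
      qed
      then show "\<exists>j \<in> Ob J. \<exists>x. \<forall>k \<in> insert b A.
          x k \<in> Ar C \<and> Dom C (x k) = Dom C (u \<cdot> v) \<and> Cod C (x k) = ob F (j, k) \<and> \<iota> j k \<cdot> x k = z k \<cdot> (u \<cdot> v)"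
        using fg by (intro bexI[of _ "Cod J f"] exI[of _ w]) auto
    qed
  qed
qed

text \<open>An element of the limit of the colimits is a matching family; lift its finitely many entries
  to one stage, then advance to a later stage where the finitely many matching conditions hold.\<close>

lemma locally_lift_limit:
  "locally l (\<lambda>u. \<exists>j \<in> Ob J. \<exists>y \<in> Ar C. Dom C y = Dom C u \<and> Cod C y = ob L j \<and>
    (\<forall>k \<in> Ob K. \<iota> j k \<cdot> (\<pi> j k \<cdot> y) = \<delta> k \<cdot> u))"
proof -
  have "locally l (\<lambda>u. \<exists>j \<in> Ob J. \<exists>x. \<forall>k \<in> Ob K.
    x k \<in> Ar C \<and> Dom C (x k) = Dom C u \<and> Cod C (x k) = ob F (j, k) \<and> \<iota> j k \<cdot> x k = \<delta> k \<cdot> u)"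
    by (rule lift_finitely_many) (auto simp: finite_Ob_K)
  then show ?thesis
  proof (rule locally_bind)
    fix u assume u: "u \<in> Ar C" "Cod C u = l" and "\<exists>j \<in> Ob J. \<exists>x. \<forall>k \<in> Ob K.
      x k \<in> Ar C \<and> Dom C (x k) = Dom C u \<and> Cod C (x k) = ob F (j, k) \<and> \<iota> j k \<cdot> x k = \<delta> k \<cdot> u"
    then obtain j x where j: "j \<in> Ob J" and x: "\<And>k. k \<in> Ob K \<Longrightarrow>
        x k \<in> Ar C \<and> Dom C (x k) = Dom C u \<and> Cod C (x k) = ob F (j, k)"
      and xz: "\<And>k. k \<in> Ob K \<Longrightarrow> \<iota> j k \<cdot> x k = \<delta> k \<cdot> u"
      by blast
    have match: "\<iota> j (Cod K g) \<cdot> (ar F (ident J j, g) \<cdot> x (Dom K g)) = \<iota> j (Cod K g) \<cdot> x (Cod K g)"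
      if g: "g \<in> Ar K" for g
    proof -
      have "\<iota> j (Cod K g) \<cdot> (ar F (ident J j, g) \<cdot> x (Dom K g)) = ar M g \<cdot> (\<iota> j (Dom K g) \<cdot> x (Dom K g))"
        by (rule cmp_extend[OF coprojection_natural[OF j g, symmetric]]) (use g j x in auto)
      also have "\<dots> = ar M g \<cdot> (\<delta> (Dom K g) \<cdot> u)" using xz g by simp
      also have "\<dots> = \<delta> (Cod K g) \<cdot> u" using \<delta>_cone[OF g] g u by (simp flip: cmp_assoc')
      finally show ?thesis using xz g by simp
    qed
    have "locally (Dom C u) (\<lambda>v. \<exists>f \<in> Ar J. Dom J f = j \<and> (\<forall>g \<in> Ar K.
      ar F (f, ident K (Cod K g)) \<cdot> ((ar F (ident J j, g) \<cdot> x (Dom K g)) \<cdot> v) =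
      ar F (f, ident K (Cod K g)) \<cdot> (x (Cod K g) \<cdot> v)))"
      by (rule identify_finitely_many[OF finite_K j]) (use x j u match in auto)
    then show "locally (Dom C u) (\<lambda>v. \<exists>j \<in> Ob J. \<exists>y \<in> Ar C. Dom C y = Dom C (u \<cdot> v) \<and> Cod C y = ob L j \<and>
      (\<forall>k \<in> Ob K. \<iota> j k \<cdot> (\<pi> j k \<cdot> y) = \<delta> k \<cdot> (u \<cdot> v)))"
    proof (rule locally_mono)
      fix v assume v: "v \<in> Ar C" "Cod C v = Dom C u" and "\<exists>f \<in> Ar J. Dom J f = j \<and> (\<forall>g \<in> Ar K.
        ar F (f, ident K (Cod K g)) \<cdot> ((ar F (ident J j, g) \<cdot> x (Dom K g)) \<cdot> v) =
        ar F (f, ident K (Cod K g)) \<cdot> (x (Cod K g) \<cdot> v))"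
      then obtain f where f: "f \<in> Ar J" "Dom J f = j" and fg: "\<And>g. g \<in> Ar K \<Longrightarrow>
        ar F (f, ident K (Cod K g)) \<cdot> (ar F (ident J j, g) \<cdot> (x (Dom K g) \<cdot> v)) =
        ar F (f, ident K (Cod K g)) \<cdot> (x (Cod K g) \<cdot> v)"
        using x j by auto
      define w where "w k = ar F (f, ident K k) \<cdot> (x k \<cdot> v)" for k
      have w: "w k \<in> Ar C" "Dom C (w k) = Dom C v" "Cod C (w k) = ob F (Cod J f, k)" if "k \<in> Ob K" for k
        using x[OF that] f v that by (auto simp: w_def)
      have "ar F (ident J (Cod J f), g) \<cdot> w (Dom K g) = w (Cod K g)" if g: "g \<in> Ar K" for g
      proof -
        have "ar F (ident J (Cod J f), g) \<cdot> ar F (f, ident K (Dom K g)) =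
            ar F (f, ident K (Cod K g)) \<cdot> ar F (ident J j, g)"
          using f g j by (simp add: F_cmp)
        then have "ar F (ident J (Cod J f), g) \<cdot> (ar F (f, ident K (Dom K g)) \<cdot> (x (Dom K g) \<cdot> v)) =
            ar F (f, ident K (Cod K g)) \<cdot> (ar F (ident J j, g) \<cdot> (x (Dom K g) \<cdot> v))"
          by (rule cmp_extend) (use f g j x v in auto)
        then show ?thesis using fg[OF g] by (simp add: w_def)
      qed
      then have "is_cone K C (fix_fst J F (Cod J f)) (Dom C v) w"
        using w v by (auto simp: is_cone_def fix_fst_def hom_def)
      then obtain y where "y \<in> hom C (Dom C v) (ob L (Cod J f))" and \<pi>y: "\<forall>k \<in> Ob K. \<pi> (Cod J f) k \<cdot> y = w k"
        using lim_at[of "Cod J f"] f unfolding is_limit_def by (metis J.Cod_in_Ob)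
      then have y: "y \<in> Ar C" "Dom C y = Dom C v" "Cod C y = ob L (Cod J f)" by (auto simp: hom_def)
      have "\<iota> (Cod J f) k \<cdot> (\<pi> (Cod J f) k \<cdot> y) = \<delta> k \<cdot> (u \<cdot> v)" if k: "k \<in> Ob K" for k
      proof -
        have "\<iota> (Cod J f) k \<cdot> (\<pi> (Cod J f) k \<cdot> y) = \<iota> j k \<cdot> (x k \<cdot> v)"
          using \<pi>y k advance_coprojection[of f k "x k \<cdot> v"] f x[OF k] v by (simp add: w_def)
        also have "\<dots> = \<delta> k \<cdot> (u \<cdot> v)"
          by (rule cmp_extend[OF xz[OF k]]) (use x[OF k] j k u v in auto)
        finally show ?thesis .
      qed
      then show "\<exists>j \<in> Ob J. \<exists>y \<in> Ar C. Dom C y = Dom C (u \<cdot> v) \<and> Cod C y = ob L j \<and>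
          (\<forall>k \<in> Ob K. \<iota> j k \<cdot> (\<pi> j k \<cdot> y) = \<delta> k \<cdot> (u \<cdot> v))"
        using y f u v by (intro bexI[of _ "Cod J f"] bexI[of _ y]) auto
    qed
  qed
qed

text \<open>Elements of a stage \<open>L j\<close> with equal images in \<open>lim M\<close> have equal coordinates, on a cover, at one
  later stage. They are therefore equal in the limit at that stage, hence in the colimit of \<open>L\<close>.\<close>

lemma identified_in_colimit:
  assumes j: "j \<in> Ob J" and y: "y \<in> Ar C" "Cod C y = ob L j"
    and z: "z \<in> Ar C" "Cod C z = ob L j" "Dom C z = Dom C y"
    and eq: "\<And>k. k \<in> Ob K \<Longrightarrow> \<iota> j k \<cdot> (\<pi> j k \<cdot> y) = \<iota> j k \<cdot> (\<pi> j k \<cdot> z)"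
  shows "\<gamma> j \<cdot> y = \<gamma> j \<cdot> z"
proof (rule locally_separated)
  have "locally (Dom C y) (\<lambda>v. \<exists>f \<in> Ar J. Dom J f = j \<and> (\<forall>k \<in> Ob K.
      ar F (f, ident K k) \<cdot> ((\<pi> j k \<cdot> y) \<cdot> v) = ar F (f, ident K k) \<cdot> ((\<pi> j k \<cdot> z) \<cdot> v)))"
    by (rule identify_finitely_many[OF finite_Ob_K j]) (use j y z eq in auto)
  then have "locally (Dom C y) (\<lambda>v. (\<gamma> j \<cdot> y) \<cdot> v = (\<gamma> j \<cdot> z) \<cdot> v)"
  proof (rule locally_mono)
    fix v assume v: "v \<in> Ar C" "Cod C v = Dom C y" and "\<exists>f \<in> Ar J. Dom J f = j \<and> (\<forall>k \<in> Ob K.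
      ar F (f, ident K k) \<cdot> ((\<pi> j k \<cdot> y) \<cdot> v) = ar F (f, ident K k) \<cdot> ((\<pi> j k \<cdot> z) \<cdot> v))"
    then obtain f where f: "f \<in> Ar J" "Dom J f = j" and fk: "\<And>k. k \<in> Ob K \<Longrightarrow>
        ar F (f, ident K k) \<cdot> (\<pi> j k \<cdot> (y \<cdot> v)) = ar F (f, ident K k) \<cdot> (\<pi> j k \<cdot> (z \<cdot> v))"
      using j y z by auto
    have nat: "\<pi> (Cod J f) k \<cdot> (ar L f \<cdot> t) = ar F (f, ident K k) \<cdot> (\<pi> j k \<cdot> t)"
      if "k \<in> Ob K" "t \<in> Ar C" "Cod C t = ob L j" for k t
      by (rule cmp_extend) (use projection_natural[OF f(1) that(1)] f that j in auto)
    have "ar L f \<cdot> (y \<cdot> v) = ar L f \<cdot> (z \<cdot> v)"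
    proof (rule limit_ext[OF lim_at[of "Cod J f"] functor_fix_fst K.category_axioms])
      fix k assume k: "k \<in> Ob K"
      show "\<pi> (Cod J f) k \<cdot> (ar L f \<cdot> (y \<cdot> v)) = \<pi> (Cod J f) k \<cdot> (ar L f \<cdot> (z \<cdot> v))"
        using nat[OF k, of "y \<cdot> v"] nat[OF k, of "z \<cdot> v"] fk[OF k] y z v by simp
    qed (use f y z v in auto)
    moreover have "\<gamma> j \<cdot> t = \<gamma> (Cod J f) \<cdot> (ar L f \<cdot> t)" if "t \<in> Ar C" "Cod C t = ob L j" for t
      using \<gamma>_advance[OF f(1), of t] f that by simp
    ultimately have "\<gamma> j \<cdot> (y \<cdot> v) = \<gamma> j \<cdot> (z \<cdot> v)" using y z v by simp
    then show "(\<gamma> j \<cdot> y) \<cdot> v = (\<gamma> j \<cdot> z) \<cdot> v" using j y z v by simp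
  qed
  then show "locally (Dom C (\<gamma> j \<cdot> y)) (\<lambda>v. (\<gamma> j \<cdot> y) \<cdot> v = (\<gamma> j \<cdot> z) \<cdot> v)" using j y by simp
qed (use j y z in auto)

lemma locally_lift_pair:
  assumes f: "f \<in> Ar C" "Cod C f = c" and g: "g \<in> Ar C" "Cod C g = c" "Dom C g = Dom C f"
  shows "locally (Dom C f) (\<lambda>u. \<exists>j \<in> Ob J. \<exists>y \<in> Ar C. \<exists>z \<in> Ar C. Dom C y = Dom C u \<and> Dom C z = Dom C u \<and>
    Cod C y = ob L j \<and> Cod C z = ob L j \<and> \<gamma> j \<cdot> y = f \<cdot> u \<and> \<gamma> j \<cdot> z = g \<cdot> u)"
proof (rule locally_bind[OF small_filtered_diagram.locally_lift[OF diagram_L colim_L f]])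
  fix u assume u: "u \<in> Ar C" "Cod C u = Dom C f"
    and "\<exists>i \<in> Ob J. \<exists>y \<in> Ar C. Dom C y = Dom C u \<and> Cod C y = ob L i \<and> \<gamma> i \<cdot> y = f \<cdot> u"
  then obtain i y where i: "i \<in> Ob J" and y: "y \<in> Ar C" "Dom C y = Dom C u" "Cod C y = ob L i"
      "\<gamma> i \<cdot> y = f \<cdot> u" by blast
  have gu: "g \<cdot> u \<in> Ar C" "Cod C (g \<cdot> u) = c" "Dom C (g \<cdot> u) = Dom C u" using g u by auto
  show "locally (Dom C u) (\<lambda>v. \<exists>j \<in> Ob J. \<exists>y \<in> Ar C. \<exists>z \<in> Ar C.
      Dom C y = Dom C (u \<cdot> v) \<and> Dom C z = Dom C (u \<cdot> v) \<and>
      Cod C y = ob L j \<and> Cod C z = ob L j \<and> \<gamma> j \<cdot> y = f \<cdot> (u \<cdot> v) \<and> \<gamma> j \<cdot> z = g \<cdot> (u \<cdot> v))"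
  proof (rule locally_mono[OF small_filtered_diagram.locally_lift[OF diagram_L colim_L gu(1,2), unfolded gu(3)]])
    fix v assume v: "v \<in> Ar C" "Cod C v = Dom C u"
      and "\<exists>i \<in> Ob J. \<exists>z \<in> Ar C. Dom C z = Dom C v \<and> Cod C z = ob L i \<and> \<gamma> i \<cdot> z = (g \<cdot> u) \<cdot> v"
    then obtain i' z where i': "i' \<in> Ob J" and z: "z \<in> Ar C" "Dom C z = Dom C v" "Cod C z = ob L i'"
        "\<gamma> i' \<cdot> z = g \<cdot> (u \<cdot> v)" using g u by auto
    obtain a b where ab: "a \<in> Ar J" "b \<in> Ar J" "Dom J a = i" "Dom J b = i'" "Cod J b = Cod J a"
      using bound[OF i i'] by blast
    have "\<gamma> i \<cdot> (y \<cdot> v) = f \<cdot> (u \<cdot> v)"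
      by (rule cmp_extend[OF y(4)]) (use i y f u v in auto)
    then have "\<gamma> (Cod J a) \<cdot> (ar L a \<cdot> (y \<cdot> v)) = f \<cdot> (u \<cdot> v)"
      using \<gamma>_advance[OF ab(1), of "y \<cdot> v"] ab y v by simp
    moreover have "\<gamma> (Cod J a) \<cdot> (ar L b \<cdot> z) = g \<cdot> (u \<cdot> v)"
      using \<gamma>_advance[OF ab(2), of z] ab z by simp
    ultimately show "\<exists>j \<in> Ob J. \<exists>y \<in> Ar C. \<exists>z \<in> Ar C.
        Dom C y = Dom C (u \<cdot> v) \<and> Dom C z = Dom C (u \<cdot> v) \<and>
        Cod C y = ob L j \<and> Cod C z = ob L j \<and> \<gamma> j \<cdot> y = f \<cdot> (u \<cdot> v) \<and> \<gamma> j \<cdot> z = g \<cdot> (u \<cdot> v)"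
      using ab y z u v by (intro bexI[of _ "Cod J a"] bexI[of _ "ar L a \<cdot> (y \<cdot> v)"] bexI[of _ "ar L b \<cdot> z"]) auto
  qed
qed

context
  fixes \<kappa>
  assumes comparison: "is_comparison J K C \<pi> \<iota> c \<gamma> l \<delta> \<kappa>"
begin

lemma \<kappa>_simps [simp]: "\<kappa> \<in> Ar C" "Dom C \<kappa> = c" "Cod C \<kappa> = l"
  using comparison by (auto simp: is_comparison_def hom_def)

lemma \<kappa>_stage:
  assumes "j \<in> Ob J" "k \<in> Ob K" "y \<in> Ar C" "Cod C y = ob L j"
  shows "\<delta> k \<cdot> (\<kappa> \<cdot> (\<gamma> j \<cdot> y)) = \<iota> j k \<cdot> (\<pi> j k \<cdot> y)"
proof -
  have "\<delta> k \<cdot> (\<kappa> \<cdot> \<gamma> j) = \<iota> j k \<cdot> \<pi> j k"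
    using comparison assms by (simp add: is_comparison_def)
  then have "\<delta> k \<cdot> ((\<kappa> \<cdot> \<gamma> j) \<cdot> y) = \<iota> j k \<cdot> (\<pi> j k \<cdot> y)"
    by (rule cmp_extend) (use assms in auto)
  then show ?thesis using assms by simp
qed

text \<open>On a cover, both elements come from a single stage \<open>L j\<close>, and equality of their images under \<open>\<kappa>\<close>
  says that their coordinates agree in \<open>M\<close>.\<close>

lemma comparison_mono: "is_mono C \<kappa>"
  unfolding is_mono_def
proof (intro conjI ballI impI)
  fix f g assume fg: "f \<in> Ar C" "g \<in> Ar C"
    "Dom C f = Dom C g \<and> Cod C f = Dom C \<kappa> \<and> Cod C g = Dom C \<kappa> \<and> \<kappa> \<cdot> f = \<kappa> \<cdot> g"
  show "f = g"
  proof (rule locally_separated)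
    show "locally (Dom C f) (\<lambda>u. f \<cdot> u = g \<cdot> u)"
    proof (rule locally_mono[OF locally_lift_pair])
      fix u assume u: "u \<in> Ar C" "Cod C u = Dom C f"
        and "\<exists>j \<in> Ob J. \<exists>y \<in> Ar C. \<exists>z \<in> Ar C. Dom C y = Dom C u \<and> Dom C z = Dom C u \<and>
          Cod C y = ob L j \<and> Cod C z = ob L j \<and> \<gamma> j \<cdot> y = f \<cdot> u \<and> \<gamma> j \<cdot> z = g \<cdot> u"
      then obtain j y z where j: "j \<in> Ob J" and yz: "y \<in> Ar C" "z \<in> Ar C" "Dom C z = Dom C y"
          "Cod C y = ob L j" "Cod C z = ob L j" and eq: "\<gamma> j \<cdot> y = f \<cdot> u" "\<gamma> j \<cdot> z = g \<cdot> u"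
        by auto
      have "\<kappa> \<cdot> (f \<cdot> u) = \<kappa> \<cdot> (g \<cdot> u)"
        by (rule cmp_extend) (use fg u in auto)
      then have "\<kappa> \<cdot> (\<gamma> j \<cdot> y) = \<kappa> \<cdot> (\<gamma> j \<cdot> z)" by (simp only: eq)
      then have "\<gamma> j \<cdot> y = \<gamma> j \<cdot> z"
        using \<kappa>_stage[OF j] yz j by (intro identified_in_colimit) metis+
      then show "f \<cdot> u = g \<cdot> u" by (simp only: eq)
    qed (use fg in auto)
  qed (use fg in auto)
qed simp

text \<open>Every element of \<open>l\<close> comes locally from a stage of \<open>L\<close> and so lies locally in the image of \<open>\<kappa>\<close>;
  since \<open>\<kappa>\<close> is monic, the identity of \<open>l\<close> factors through it.\<close>

lemma comparison_iso: "is_iso C \<kappa>"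
proof (rule mono_split_iso[OF comparison_mono])
  have "locally l (\<lambda>u. sub_le C (ident C l \<cdot> u) \<kappa>)"
  proof (rule locally_mono[OF locally_lift_limit])
    fix u assume u: "u \<in> Ar C" "Cod C u = l"
      and "\<exists>j \<in> Ob J. \<exists>y \<in> Ar C. Dom C y = Dom C u \<and> Cod C y = ob L j \<and>
        (\<forall>k \<in> Ob K. \<iota> j k \<cdot> (\<pi> j k \<cdot> y) = \<delta> k \<cdot> u)"
    then obtain j y where j: "j \<in> Ob J" and y: "y \<in> Ar C" "Dom C y = Dom C u" "Cod C y = ob L j"
        "\<And>k. k \<in> Ob K \<Longrightarrow> \<iota> j k \<cdot> (\<pi> j k \<cdot> y) = \<delta> k \<cdot> u" by blast
    have "u = \<kappa> \<cdot> (\<gamma> j \<cdot> y)"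
      by (rule limit_ext[OF lim_M functor_M K.category_axioms]) (use j y u \<kappa>_stage in auto)
    then show "sub_le C (ident C l \<cdot> u) \<kappa>"
      using u j y(1-3) by - (rule sub_leI[of _ _ "\<gamma> j \<cdot> y"], auto)
  qed
  then show "sub_le C (ident C (Cod C \<kappa>)) \<kappa>"
    using comparison_mono by - (rule locally_factor, auto)
qed

end

end

theorem theorem5p9:
  fixes r :: "'l rel"
    and D :: "('o, 'a) cat"
    and J :: "('i, 'j) cat"
    and K :: "('k, 'n) cat"
  assumes "Cinfinite r" and "regularCard r"
    and "pretopos r D"
    and "filtered_category J" and "|Ar J| <o r"
    and "finite_category K"
  shows "colimits_commute_with_limits J K D"
  unfolding colimits_commute_with_limits_def
proof (intro allI impI, elim conjE)
  fix F L \<pi> M \<iota> c \<gamma> l \<delta>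
  assume F: "is_functor (prod_cat J K) D F"
    and L: "is_limit_functor J K D F L \<pi>" and M: "is_colimit_functor J K D F M \<iota>"
    and c: "is_colimit J D L c \<gamma>" and l: "is_limit K D M l \<delta>"
  have geo: "geometric_category r D" using assms(3) by (simp add: pretopos_def)
  then have D: "category D" "has_finite_limits D"
    by (auto simp: geometric_category_def coherent_category_def regular_category_def)
  have J: "category J" using assms(4) by (simp add: filtered_category_def)
  have K: "category K" "finite (Ar K)" using assms(6) by (auto simp: finite_category_def)
  interpret D: category D by fact
  interpret J: category J by fact
  interpret K: category K by fact
  interpret limit_colimit_square D r J K F L \<pi> M \<iota> c \<gamma> l \<delta>
    using assms D geo K F L M c l by unfold_locales
  obtain \<kappa> where \<kappa>: "is_comparison J K D \<pi> \<iota> c \<gamma> l \<delta> \<kappa>"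
    using comparison_ex1[OF D(1) J K(1) F L M c l] by blast
  then show "\<exists>\<kappa>. is_comparison J K D \<pi> \<iota> c \<gamma> l \<delta> \<kappa> \<and> is_iso D \<kappa>"
    using comparison_iso by blast
qed

end
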